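(* Let $I \subset A$ and $J \subset B$ be monomial ideals, let $\gamma = (\alpha,\beta) \in \mathbb{Z}^m \times \mathbb{Z}^{n-m} = \mathbb{Z}^n$, and let $s \ge 1$. For an integer vector $\gamma$ write $|\gamma| := \sum_i \gamma_i$ (and similarly for $\alpha$, $\beta$). (1) $\Delta_\gamma(IJ) = (\Delta_\alpha(I) \ast \Delta_Y) \cup (\Delta_X \ast \Delta_\beta(J))$. (2) $\Delta_\gamma((I+J)^s) = \bigcup_{j=1}^s \Delta_\alpha(I^j) \ast \Delta_\beta(J^{s-j+1})$. (3) $\Delta_\gamma((I+J)^{(s)}) = \bigcup_{j=1}^s \Delta_\alpha(I^{(j)}) \ast \Delta_\beta(J^{(s-j+1)})$. (4) Suppose in addition that $I$ and $J$ are squarefree. Let $$\mathcal{A} = \begin{cases} \{F \in \Delta_\alpha(I^{s-|\beta|}) : F \neq \emptyset\}, & \text{if } G_\beta = \emptyset \text{ and } |\beta| < s, \\ \emptyset, & \text{if } G_\beta \neq \emptyset \text{ or } |\beta| \geq s, \end{cases}$$ $$\mathcal{B} = \begin{cases} \{F \in \Delta_\beta(J^{s-|\alpha|}) : F \neq \emptyset\}, & \text{if } G_\alpha = \emptyset \text{ and } |\alpha| < s, \\ \emptyset, & \text{if } G_\alpha \neq \emptyset \text{ or } |\alpha| \geq s. \end{cases}$$ Then the set of nonempty faces of $\Delta_\gamma((I+J+\mathfrak{m}\mathfrak{n})^s)$ is $\mathcal{A} \cup \mathcal{B}$. (5) Suppose in addition that $I$ and $J$ are squarefree. Let $$\mathcal{A}'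 = \begin{cases} \{F \in \Delta_\alpha(I^{(s-|\beta|)}) : F \neq \emptyset\}, & \text{if } G_\beta = \emptyset \text{ and } |\beta| < s, \\ \emptyset, & \text{if } G_\beta \neq \emptyset \text{ or } |\beta| \geq s, \end{cases}$$ $$\mathcal{B}' = \begin{cases} \{F \in \Delta_\beta(J^{(s-|\alpha|)}) : F \neq \emptyset\}, & \text{if } G_\alpha = \emptyset \text{ and } |\alpha| < s, \\ \emptyset, & \text{if } G_\alpha \neq \emptyset \text{ or } |\alpha| \geq s. \end{cases}$$ Then the set of nonempty faces of $\Delta_\gamma((I+J+\mathfrak{m}\mathfrak{n})^{(s)})$ is $\mathcal{A}' \cup \mathcal{B}'$. (6) Let $I_1 \subseteq I_2 \subseteq A$ and $J_1 \subseteq J_2 \subseteq B$ be monomial ideals and let $H = I_1J_2 + I_2J_1 \subset S$. Then $$\Delta_\gamma(H) = [\Delta_X \ast \Delta_\beta(J_2)] \cup [\Delta_\alpha(I_1) \ast \Delta_\beta(J_1)] \cup [\Delta_\alpha(I_2) \ast \Delta_Y].$$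
   Context: Let $k$ be a field of characteristic zero, $A = k[x_1,\ldots,x_m]$, $B = k[x_{m+1},\ldots,x_n]$, $S = A \otimes_k B = k[x_1,\ldots,x_n]$, with $\mathfrak{m} = (x_1,\ldots,x_m)$ and $\mathfrak{n} = (x_{m+1},\ldots,x_n)$. Ideals of $A$ and $B$ are identified with their extensions to $S$ when sums and products are formed in $S$. A simplicial complex is a collection of subsets (faces) of a finite set closed under taking subsets; the void complex has no faces, the irrelevant complex has only the face $\emptyset$. The join is $\Delta \ast \Gamma = \{\sigma \cup \tau : \sigma \in \Delta, \tau \in \Gamma\}$ (void if either is void). $\Delta_X$ is the full simplex on $\{1,\ldots,m\}$ and $\Delta_Y$ the full simplex on $\{m+1,\ldots,n\}$. For $\gamma \in \mathbb{Z}^n$, $x^\gamma = x_1^{\gamma_1}\cdots x_n^{\gamma_n}$ and $G_\gamma = \{i : \gamma_i < 0\}$. For $F \subseteq [n] = \{1,\ldots,n\}$, $S_F = S[x_i^{-1} : i \in F]$. For a monomial ideal $K \subseteq S$, the degree complex is $\Delta_\gamma(K) = \{F \subseteq [n]\setminus G_\gamma : x^\gamma \notin K S_{F \cup G_\gamma}\}$. For $\gamma = (\alpha,\beta)$, $\alpha$ is indexed by $\{1,\ldots,m\}$ and $\beta$ by $\{m+1,\ldots,n\}$; for a monomial ideal of $A$ (resp. $B$), $\Delta_\alpha(\cdot)$ (resp. $\Delta_\beta(\cdot)$) is the degree complex formed in $A$ on the vertex set $\{1,\ldots,m\}$ (resp. in $B$ on $\{m+1,\ldots,n\}$), and $G_\alpha,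 G_\beta$ are the corresponding sets of negative indices. The $s$-th symbolic power of an ideal $K$ of a polynomial ring $R$ is $K^{(s)} = R \cap \bigcap_{\mathfrak{p} \in \mathrm{Ass}(K)} \mathfrak{p}^s R_\mathfrak{p}$ (in the paper's notation), where $\mathrm{Ass}(K)$ is the set of associated primes of $K$; for a squarefree monomial ideal this is $\bigcap_{\mathfrak{p} \in \mathrm{Ass}(K)} \mathfrak{p}^s$.
   Formalization: In (1) and (6) the right-hand side is restricted to faces contained in [n] \ G_γ (the literal equality fails, e.g. I = J = 0, γ = (0,-1)); in (4) and (5) I and J are taken to be proper ideals (the claim fails for I = A, J = 0, γ = 0, s = 1). *)

theory Defs
  imports
    "HOL-Library.Poly_Mapping"
    "HOL-Computational_Algebra.Fraction_Field"
    "HOL-Algebra.Ideal_Product"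
    "HOL-Algebra.Generated_Rings"
    "HOL-Decision_Procs.Algebra_Aux"
begin

text \<open>
  Polynomials over \<open>'k\<close> in the variables \<open>x\<^sub>0, x\<^sub>1, x\<^sub>2, \<dots>\<close>: finitely supported maps from exponent
  vectors to coefficients, with the convolution product of \<^theory>\<open>HOL-Library.Poly_Mapping\<close>.
  The polynomial ring on a set \<open>V\<close> of variables is a subring, so the inclusions
  of \<open>A\<close> and \<open>B\<close> into \<open>S\<close> are inclusions of sets.
\<close>

type_synonym 'k mpol = "(nat \<Rightarrow>\<^sub>0 nat) \<Rightarrow>\<^sub>0 'k"

definition mpol_ring :: "nat set \<Rightarrow> 'k::field mpol ring" where
  "mpol_ring V = cring_class_ops\<lparr>carrier := {f. \<forall>t\<in>Poly_Mapping.keys f. Poly_Mapping.keys t \<subseteq> V}\<rparr>"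

abbreviation monomial :: "(nat \<Rightarrow>\<^sub>0 nat) \<Rightarrow> 'k::field mpol" where
  "monomial t \<equiv> Poly_Mapping.single t 1"

definition indet :: "nat \<Rightarrow> 'k::field mpol" where
  "indet i = monomial (Poly_Mapping.single i 1)"

text \<open>The zero ideal and the unit ideal are monomial ideals (\<open>M = {}\<close> and \<open>M = {0}\<close>).\<close>

definition monomial_ideal :: "nat set \<Rightarrow> 'k::field mpol set \<Rightarrow> bool" where
  "monomial_ideal V K \<longleftrightarrow>
     (\<exists>M. (\<forall>t\<in>M. Poly_Mapping.keys t \<subseteq> V) \<and> K = Idl\<^bsub>mpol_ring V\<^esub> (monomial ` M))"

definition squarefree_monomial_ideal :: "nat set \<Rightarrow> 'k::field mpol set \<Rightarrow> bool" where
  "squarefree_monomial_ideal V K \<longleftrightarrow>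
     (\<exists>M. (\<forall>t\<in>M. Poly_Mapping.keys t \<subseteq> V \<and> (\<forall>i. Poly_Mapping.lookup t i \<le> 1)) \<and>
          K = Idl\<^bsub>mpol_ring V\<^esub> (monomial ` M))"

text \<open>The power \<open>K\<^sup>s\<close> in the library's semiring of ideals; in particular \<open>K\<^sup>0 = R\<close>.\<close>

abbreviation ideal_power :: "'a ring \<Rightarrow> 'a set \<Rightarrow> nat \<Rightarrow> 'a set" where
  "ideal_power R K s \<equiv> K [^]\<^bsub>ideals_set R\<^esub> s"

text \<open>
  All localizations are realised as subrings of one field, the field of fractions of the
  domain \<^typ>\<open>'k mpol\<close>, in which \<open>f\<close> is identified with \<open>f / 1\<close>.
\<close>

abbreviation emb :: "'k::field mpol \<Rightarrow> 'k mpol fract" where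
  "emb f \<equiv> Fraction_Field.Fract f 1"

definition loc_vars :: "nat set \<Rightarrow> nat set \<Rightarrow> 'k::field mpol fract ring" where
  "loc_vars V F = cring_class_ops\<lparr>carrier :=
     generate_ring cring_class_ops
       (emb ` carrier (mpol_ring V) \<union> {inverse (emb (indet i)) | i. i \<in> F})\<rparr>"

definition loc_prime :: "nat set \<Rightarrow> 'k::field mpol set \<Rightarrow> 'k mpol fract ring" where
  "loc_prime V p = cring_class_ops\<lparr>carrier :=
     {Fraction_Field.Fract f u | f u. f \<in> carrier (mpol_ring V) \<and> u \<in> carrier (mpol_ring V) - p}\<rparr>"

text \<open>
  In the degree complex on the vertex set \<open>V\<close> only the coordinates \<open>\<gamma> i\<close> with \<open>i \<in> V\<close> matter, so
  for \<open>\<gamma> = (\<alpha>, \<beta>)\<close> the vectors \<open>\<alpha>\<close> and \<open>\<beta>\<close> are given by the same function \<open>\<gamma>\<close>, used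
  with the vertex set of \<open>A\<close> and of \<open>B\<close> respectively.
\<close>

definition laurent_monomial :: "nat set \<Rightarrow> (nat \<Rightarrow> int) \<Rightarrow> 'k::field mpol fract" where
  "laurent_monomial V \<gamma> = (\<Prod>i\<in>V. emb (indet i) powi \<gamma> i)"

definition neg_indices :: "nat set \<Rightarrow> (nat \<Rightarrow> int) \<Rightarrow> nat set" where
  "neg_indices V \<gamma> = {i \<in> V. \<gamma> i < 0}"

definition degree_complex :: "nat set \<Rightarrow> (nat \<Rightarrow> int) \<Rightarrow> 'k::field mpol set \<Rightarrow> nat set set" where
  "degree_complex V \<gamma> K =
     {F. F \<subseteq> V - neg_indices V \<gamma> \<and>
         laurent_monomial V \<gamma> \<notin> Idl\<^bsub>loc_vars V (F \<union> neg_indices V \<gamma>)\<^esub> (emb ` K)}"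

text \<open>
  \<open>Ass(K)\<close>: the primes that are annihilators of an element of \<open>R/K\<close>.
\<close>

definition assoc_primes :: "'a ring \<Rightarrow> 'a set \<Rightarrow> 'a set set" where
  "assoc_primes R K =
     {p. primeideal p R \<and> (\<exists>f\<in>carrier R. p = {g \<in> carrier R. g \<otimes>\<^bsub>R\<^esub> f \<in> K})}"

text \<open>
  \<open>K\<^sup>(\<^sup>s\<^sup>) = R \<inter> \<Inter>\<^sub>p p\<^sup>s R\<^sub>p\<close>, with \<open>p\<close> ranging over \<open>Ass(K)\<close>. Note that it is \<open>p\<^sup>s R\<^sub>p\<close>, not \<open>K\<^sup>s R\<^sub>p\<close>; the two
  agree when \<open>K\<close> is radical.
\<close>

definition symbolic_power :: "nat set \<Rightarrow> 'k::field mpol set \<Rightarrow> nat \<Rightarrow> 'k mpol set" where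
  "symbolic_power V K s =
     {f \<in> carrier (mpol_ring V).
        \<forall>p \<in> assoc_primes (mpol_ring V) K.
          emb f \<in> Idl\<^bsub>loc_prime V p\<^esub> (emb ` ideal_power (mpol_ring V) p s)}"

text \<open>
  A simplicial complex is given by its set of faces: the void complex is \<open>{}\<close>, the irrelevant
  complex is \<open>{{}}\<close>, and the full simplex on \<open>V\<close> is \<^term>\<open>Pow V\<close>.
\<close>

definition cjoin :: "'v set set \<Rightarrow> 'v set set \<Rightarrow> 'v set set" where
  "cjoin D E = {\<sigma> \<union> \<tau> | \<sigma> \<tau>. \<sigma> \<in> D \<and> \<tau> \<in> E}"

text \<open>
  \<open>\<Delta>\<^sub>\<gamma>(K)\<close> is a complex on the vertex set \<open>V - G\<^sub>\<gamma>\<close>. A join with a full simplex \<open>Pow W\<close>, \<open>W \<subseteq> V\<close>, may have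
  faces meeting \<open>G\<^sub>\<gamma>\<close>, so it has to be restricted to \<open>V - G\<^sub>\<gamma>\<close> before the two are compared; this changes
  nothing if \<open>\<gamma>\<close> has no negative entries.
\<close>

definition restrict_complex :: "'v set set \<Rightarrow> 'v set \<Rightarrow> 'v set set" where
  "restrict_complex D W = {F \<in> D. F \<subseteq> W}"

definition nonempty_faces :: "'v set set \<Rightarrow> 'v set set" where
  "nonempty_faces D = {F \<in> D. F \<noteq> {}}"

end

theory Submission
  imports Defs
begin

text \<open>
  Every ideal in sight is spanned by monomials, hence determined by an up-closed set of exponent vectors,
  and \<open>F\<close> is a face of its degree complex iff no exponent \<open>t\<close> in that set satisfies \<open>t\<^sub>i \<le> \<gamma>\<^sub>i\<close> for all \<open>i\<close>
  outside \<open>F \<union> G\<^sub>\<gamma>\<close>. The associated primes of a monomial ideal are generated by variables: if \<open>g f\<close> lies in the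
  ideal, then a power of the leading monomial of \<open>g\<close> times \<open>f\<close> does too. Powers of such primes are primary,
  so \<open>p\<^sup>s R\<^sub>p\<close> contracts to \<open>p\<^sup>s\<close>, which is the set of polynomials all of whose terms have degree at least \<open>s\<close>
  in the variables of \<open>p\<close>. All six formulas thereby become statements on exponent vectors in two disjoint blocks
  of variables.
\<close>

section \<open>Ideals spanned by monomials\<close>

text \<open>For I + J the two blocks do not interact. The s-th power contains a monomial locally iff
  for some i its x-part lies in I^i and its y-part in J^(s-i). Both conditions weaken as the power
  drops, so failure is witnessed by a single j, the first power of I that fails; this is the origin
  of the index s - j + 1. Symbolic powers need no expansion: the associated primes of I + J are the
  sums p + q, and degrees add. The term mn couples the blocks, and this is why only nonempty faces
  are described. A nonempty F inverts some variable, say x_i; then mn yields every y_k, so I + J +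
  mn becomes I + n as long as no y_k is inverted. The monomial x^\<gamma> supplies |\<beta>| factors
  from n, and I must supply the remaining s - |\<beta>|. If variables of both blocks are inverted,
  the ideal becomes the unit ideal. Hence no face mixes the blocks, and a negative entry of \<beta>,
  which inverts a y_k, leaves no face in the first block. All this relies on I and J being proper,
  so that I lies in m and J in n.\<close>

definition expo :: "nat set \<Rightarrow> (nat \<Rightarrow>\<^sub>0 nat) set" where
  "expo V = {t. Poly_Mapping.keys t \<subseteq> V}"

text \<open>These are the monoid ideals of \<open>expo V\<close>. The empty set is allowed and
  stands for the zero ideal, \<open>expo V\<close> for the unit ideal.\<close>

definition upset :: "nat set \<Rightarrow> (nat \<Rightarrow>\<^sub>0 nat) set \<Rightarrow> bool" where
  "upset V E \<longleftrightarrow> E \<subseteq> expo V \<and> (\<forall>t\<in>E. \<forall>u\<in>expo V. t + u \<in> E)"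

definition mspan :: "(nat \<Rightarrow>\<^sub>0 nat) set \<Rightarrow> 'k::field mpol set" where
  "mspan E = {f. Poly_Mapping.keys f \<subseteq> E}"

definition msum :: "(nat \<Rightarrow>\<^sub>0 nat) set \<Rightarrow> (nat \<Rightarrow>\<^sub>0 nat) set \<Rightarrow> (nat \<Rightarrow>\<^sub>0 nat) set" where
  "msum E F = {t + u | t u. t \<in> E \<and> u \<in> F}"

text \<open>Starting from \<open>expo V\<close> and not from \<open>{0}\<close> keeps every stage
  up-closed and gives the unit ideal for s = 0, in accordance with
  \<open>ideal_power\<close>.\<close>

primrec epow :: "nat set \<Rightarrow> (nat \<Rightarrow>\<^sub>0 nat) set \<Rightarrow> nat \<Rightarrow> (nat \<Rightarrow>\<^sub>0 nat) set" where
  "epow V E 0 = expo V"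
| "epow V E (Suc s) = msum (epow V E s) E"

lemma keys_add_nat: "Poly_Mapping.keys (t + u) = Poly_Mapping.keys t \<union> Poly_Mapping.keys (u :: nat \<Rightarrow>\<^sub>0 nat)"
  by (auto simp: in_keys_iff lookup_add)

lemma expo_0 [simp]: "0 \<in> expo V"
  by (simp add: expo_def)

lemma expo_add [simp]: "t + u \<in> expo V \<longleftrightarrow> t \<in> expo V \<and> u \<in> expo V"
  by (auto simp: expo_def keys_add_nat)

lemma expo_mono: "V \<subseteq> W \<Longrightarrow> expo V \<subseteq> expo W"
  by (auto simp: expo_def)

lemma upset_expo [simp]: "upset V (expo V)"
  by (simp add: upset_def)

lemma upsetD: "upset V E \<Longrightarrow> t \<in> E \<Longrightarrow> u \<in> expo V \<Longrightarrow> t + u \<in> E"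
  by (simp add: upset_def)

lemma upsetD': "upset V E \<Longrightarrow> t \<in> E \<Longrightarrow> u \<in> expo V \<Longrightarrow> u + t \<in> E"
  by (simp add: upset_def add.commute)

lemma upset_sub: "upset V E \<Longrightarrow> t \<in> E \<Longrightarrow> t \<in> expo V"
  by (auto simp: upset_def)

lemma upset_msum: "upset V E \<Longrightarrow> upset V F \<Longrightarrow> upset V (msum E F)"
  unfolding upset_def msum_def
  by (fastforce simp: subset_iff add.assoc)

lemma upset_Un: "upset V E \<Longrightarrow> upset V F \<Longrightarrow> upset V (E \<union> F)"
  by (auto simp: upset_def)

lemma upset_epow: "upset V E \<Longrightarrow> upset V (epow V E s)"
  by (induction s) (auto intro: upset_msum)

lemma upset_gen: "M \<subseteq> expo V \<Longrightarrow> upset V (msum M (expo V))"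
  unfolding upset_def msum_def
  by (fastforce simp: subset_iff add.assoc)

lemma subset_gen: "E \<subseteq> msum E (expo V)"
proof
  fix t assume "t \<in> E"
  then have "t + 0 \<in> msum E (expo V)" unfolding msum_def using expo_0 by blast
  then show "t \<in> msum E (expo V)" by simp
qed

lemma gen_upset: "upset V E \<Longrightarrow> msum E (expo V) = E"
  using subset_gen[of E V] by (auto simp: msum_def upsetD)

lemma carrier_mpol_ring: "carrier (mpol_ring V) = mspan (expo V)"
  by (auto simp: mpol_ring_def mspan_def expo_def)

lemma mpol_ring_simps [simp]:
  "\<zero>\<^bsub>mpol_ring V\<^esub> = 0" "\<one>\<^bsub>mpol_ring V\<^esub> = 1"
  "f \<oplus>\<^bsub>mpol_ring V\<^esub> g = f + g" "f \<otimes>\<^bsub>mpol_ring V\<^esub> g = f * g"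
  by (simp_all add: mpol_ring_def cring_class_ops_def)

lemma mspan_0 [simp]: "0 \<in> mspan E"
  by (simp add: mspan_def)

lemma mspan_add: "f \<in> mspan E \<Longrightarrow> g \<in> mspan E \<Longrightarrow> f + g \<in> mspan E"
  using keys_add by (fastforce simp: mspan_def)

lemma keys_uminus: "Poly_Mapping.keys (- f) = Poly_Mapping.keys (f :: 'k::field mpol)"
  by (auto simp: in_keys_iff)

lemma mspan_uminus: "f \<in> mspan E \<Longrightarrow> - f \<in> mspan E"
  by (simp add: mspan_def keys_uminus)

lemma mspan_mult: "f \<in> mspan E \<Longrightarrow> g \<in> mspan F \<Longrightarrow> f * g \<in> mspan (msum E F)"
  using keys_mult[of f g] by (fastforce simp: mspan_def msum_def)

lemma mspan_mono: "E \<subseteq> F \<Longrightarrow> mspan E \<subseteq> mspan F"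
  by (auto simp: mspan_def)

lemma mspan_subset_iff: "mspan E \<subseteq> (mspan F :: 'k::field mpol set) \<longleftrightarrow> E \<subseteq> F"
proof
  assume *: "mspan E \<subseteq> (mspan F :: 'k mpol set)"
  show "E \<subseteq> F"
  proof
    fix t assume "t \<in> E"
    then have "(monomial t :: 'k mpol) \<in> mspan E" by (simp add: mspan_def)
    with * have "(monomial t :: 'k mpol) \<in> mspan F" by blast
    then show "t \<in> F" by (simp add: mspan_def)
  qed
qed (rule mspan_mono)

lemma mspan_eq_iff: "mspan E = (mspan F :: 'k::field mpol set) \<longleftrightarrow> E = F"
  by (auto simp: mspan_subset_iff set_eq_subset)

lemma monomial_in_mspan [simp]: "(monomial t :: 'k::field mpol) \<in> mspan E \<longleftrightarrow> t \<in> E"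
  by (simp add: mspan_def)

lemma single_in_mspan: "t \<in> E \<Longrightarrow> Poly_Mapping.single t c \<in> mspan E"
  by (simp add: mspan_def)

lemma poly_sum_monomials:
  "(\<Sum>t\<in>Poly_Mapping.keys f. Poly_Mapping.single t (Poly_Mapping.lookup f t)) = (f :: 'k::field mpol)"
  by (rule poly_mapping_eqI) (simp add: lookup_sum lookup_single when_def in_keys_iff)

lemma msum_upset_subset: "upset V E \<Longrightarrow> msum (expo V) E \<subseteq> E"
  by (auto simp: msum_def upsetD')

section \<open>Subrings of an ambient commutative ring, and their ideals\<close>

abbreviation class_subring :: "'a::comm_ring_1 set \<Rightarrow> 'a ring" where
  "class_subring C \<equiv> cring_class_ops\<lparr>carrier := C\<rparr>"

text \<open>The polynomial ring and both kinds of localization are an ambient ring with a smaller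
  carrier, so this one closure test serves all three.\<close>

lemma cring_class_subring:
  fixes C :: "'a::comm_ring_1 set"
  assumes "1 \<in> C" "\<And>f. f \<in> C \<Longrightarrow> - f \<in> C" "\<And>f g. f \<in> C \<Longrightarrow> g \<in> C \<Longrightarrow> f + g \<in> C"
    "\<And>f g. f \<in> C \<Longrightarrow> g \<in> C \<Longrightarrow> f * g \<in> C"
  shows "cring (class_subring C)"
proof -
  note R = cring_class[where 'a = 'a]
  have *: "subring C (cring_class_ops :: 'a ring)"
    by (rule ring.subringI[OF cring.axioms(1)[OF R]])
      (simp_all add: assms carrier_class subset_iff one_class plus_class times_class uminus_class)
  show ?thesis
    using cring.subcringI'[OF R *] ring.subcring_iff[OF cring.axioms(1)[OF R], of C]
    by (simp add: carrier_class subset_iff)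
qed

lemma ideal_class_subringI:
  fixes C :: "'a::comm_ring_1 set"
  assumes R: "cring (class_subring C)" and "K \<subseteq> C" "0 \<in> K"
    and "\<And>f g. f \<in> K \<Longrightarrow> g \<in> K \<Longrightarrow> f + g \<in> K"
    and "\<And>f g. f \<in> C \<Longrightarrow> g \<in> K \<Longrightarrow> f * g \<in> K"
  shows "ideal K (class_subring C)"
proof -
  interpret R: cring "class_subring C" by (rule R)
  show ?thesis
  proof (rule idealI)
    show "subgroup K (add_monoid (class_subring C))"
    proof (rule R.add.subgroupI)
      show "K \<subseteq> carrier (class_subring C)" "K \<noteq> {}" using assms by auto
      \<comment> \<open>Negatives come from absorption: -f is (-1) times f.\<close>
      fix f assume f: "f \<in> K"
      then have *: "f \<in> carrier (class_subring C)" using assms by auto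
      have "\<ominus>\<^bsub>class_subring C\<^esub> f = (\<ominus>\<^bsub>class_subring C\<^esub> \<one>\<^bsub>class_subring C\<^esub>) \<otimes>\<^bsub>class_subring C\<^esub> f"
        using * by (simp only: R.l_minus R.one_closed R.l_one)
      moreover have "\<ominus>\<^bsub>class_subring C\<^esub> \<one>\<^bsub>class_subring C\<^esub> \<in> C"
        using R.a_inv_closed[OF R.one_closed] by simp
      ultimately show "\<ominus>\<^bsub>class_subring C\<^esub> f \<in> K"
        using assms(5)[OF _ f] by (simp add: cring_class_ops_def)
    qed (use assms(4) in \<open>simp add: cring_class_ops_def\<close>)
    show "ring (class_subring C)" by (rule R.ring_axioms)
    fix a x assume ax: "a \<in> K" "x \<in> carrier (class_subring C)"
    show "x \<otimes>\<^bsub>class_subring C\<^esub> a \<in> K" "a \<otimes>\<^bsub>class_subring C\<^esub> x \<in> K"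
      using assms(5)[of x a] ax by (simp_all add: cring_class_ops_def mult.commute)
  qed
qed

lemma mpol_ring_eq: "mpol_ring V = class_subring (mspan (expo V))"
  by (simp add: mpol_ring_def mspan_def expo_def subset_iff Ball_def)

lemma cring_mpol_ring: "cring (mpol_ring V :: 'k::field mpol ring)"
  unfolding mpol_ring_eq
proof (rule cring_class_subring)
  fix f g :: "'k mpol" assume "f \<in> mspan (expo V)" "g \<in> mspan (expo V)"
  then show "f * g \<in> mspan (expo V)"
    using mspan_mult[of f "expo V" g "expo V"] mspan_mono[OF msum_upset_subset[OF upset_expo]] by blast
next
  show "1 \<in> (mspan (expo V) :: 'k mpol set)" by (simp add: mspan_def)
qed (auto intro: mspan_add mspan_uminus)

lemma ideal_mspan:
  assumes "upset V E"
  shows "ideal (mspan E :: 'k::field mpol set) (mpol_ring V)"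
  unfolding mpol_ring_eq
proof (rule ideal_class_subringI[OF cring_mpol_ring[unfolded mpol_ring_eq]])
  show "mspan E \<subseteq> (mspan (expo V) :: 'k mpol set)"
    using assms by (simp add: upset_def mspan_mono)
  fix f g :: "'k mpol" assume "f \<in> mspan (expo V)" "g \<in> mspan E"
  then show "f * g \<in> mspan E"
    using mspan_mult[of f "expo V" g E] mspan_mono[OF msum_upset_subset[OF assms]]
    unfolding carrier_mpol_ring by blast
qed (auto intro: mspan_add)

text \<open>A term c x^(a+b) with a in M is x^a times an element of the ring, so K contains every
  term of f, and f is their finite sum. The lower bounds for generated ideals, for products and for
  primes all rest on this.\<close>

lemma mspan_subset_ideal:
  assumes K: "ideal K (mpol_ring V)" and M: "\<And>t. t \<in> M \<Longrightarrow> monomial t \<in> K"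
  shows "(mspan (msum M (expo V)) :: 'k::field mpol set) \<subseteq> K"
proof
  interpret K: ideal K "mpol_ring V :: 'k mpol ring" by (rule K)
  fix f :: "'k mpol" assume f: "f \<in> mspan (msum M (expo V))"
  have "(\<Sum>t\<in>T. Poly_Mapping.single t (Poly_Mapping.lookup f t)) \<in> K"
    if "finite T" "T \<subseteq> msum M (expo V)" for T
    using that
  proof (induction T rule: finite_induct)
    case empty
    then show ?case using additive_subgroup.zero_closed[OF K.additive_subgroup_axioms] by simp
  next
    case (insert t T)
    obtain a b where ab: "t = a + b" "a \<in> M" "b \<in> expo V"
      using insert.prems by (auto simp: msum_def)
    have "monomial a * Poly_Mapping.single b (Poly_Mapping.lookup f t) \<in> K"
      using K.I_r_closed[OF M[OF ab(2)], of "Poly_Mapping.single b (Poly_Mapping.lookup f t)"] ab(3)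
      by (simp add: carrier_mpol_ring single_in_mspan)
    then have "Poly_Mapping.single t (Poly_Mapping.lookup f t) \<in> K"
      by (simp add: mult_single ab(1))
    then show ?case using insert additive_subgroup.a_closed[OF K.additive_subgroup_axioms] by simp
  qed
  from this[of "Poly_Mapping.keys f"] f show "f \<in> K"
    by (simp add: poly_sum_monomials mspan_def)
qed

text \<open>Applied to two generating sets, the monomials of M alone and the whole span of M. Lying
  between the monomials and the claimed ideal is enough to squeeze the generated ideal.\<close>

lemma Idl_eq_mspan:
  assumes "M \<subseteq> expo V" and "\<And>t. t \<in> M \<Longrightarrow> monomial t \<in> K"
    and "K \<subseteq> (mspan (msum M (expo V)) :: 'k::field mpol set)"
  shows "Idl\<^bsub>mpol_ring V\<^esub> K = mspan (msum M (expo V))"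
proof
  interpret R: cring "mpol_ring V :: 'k mpol ring" by (rule cring_mpol_ring)
  note id = ideal_mspan[OF upset_gen[OF assms(1)], where 'k='k]
  show "Idl\<^bsub>mpol_ring V\<^esub> K \<subseteq> mspan (msum M (expo V))"
    using R.genideal_minimal[OF id assms(3)] .
  have K: "K \<subseteq> carrier (mpol_ring V)"
    using assms(3) ideal.Icarr[OF id] by blast
  show "mspan (msum M (expo V)) \<subseteq> Idl\<^bsub>mpol_ring V\<^esub> K"
    using R.genideal_self[OF K] assms(2) by (intro mspan_subset_ideal R.genideal_ideal[OF K]) auto
qed

lemma Idl_monomials:
  assumes "M \<subseteq> expo V"
  shows "Idl\<^bsub>mpol_ring V\<^esub> (monomial ` M) = (mspan (msum M (expo V)) :: 'k::field mpol set)"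
proof (rule Idl_eq_mspan[OF assms])
  show "monomial ` M \<subseteq> (mspan (msum M (expo V)) :: 'k::field mpol set)"
    by (auto simp: msum_def) (metis add.right_neutral expo_0)
qed auto

text \<open>With E in a smaller set of variables this describes the extension to S of an ideal of A
  or B.\<close>

lemma Idl_mspan:
  assumes "E \<subseteq> expo V"
  shows "Idl\<^bsub>mpol_ring V\<^esub> (mspan E) = (mspan (msum E (expo V)) :: 'k::field mpol set)"
proof (rule Idl_eq_mspan[OF assms])
  show "mspan E \<subseteq> (mspan (msum E (expo V)) :: 'k::field mpol set)"
    unfolding mspan_subset_iff by (auto simp: msum_def) (metis add.right_neutral expo_0)
qed simp

lemma monomial_ideal_mspan:
  assumes "monomial_ideal V (K :: 'k::field mpol set)"
  obtains E where "upset V E" "K = mspan E"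
proof -
  from assms obtain M where "M \<subseteq> expo V" "K = Idl\<^bsub>mpol_ring V\<^esub> (monomial ` M)"
    unfolding monomial_ideal_def by (auto simp: expo_def)
  then show ?thesis using that upset_gen Idl_monomials by metis
qed

text \<open>A polynomial is split term by term according to whether the exponent lies in E;
  exponents in both sets go to the first summand.\<close>

lemma set_add_mspan:
  "mspan E <+>\<^bsub>mpol_ring V\<^esub> mspan F = (mspan (E \<union> F) :: 'k::field mpol set)"
proof
  show "mspan E <+>\<^bsub>mpol_ring V\<^esub> mspan F \<subseteq> (mspan (E \<union> F) :: 'k mpol set)"
    unfolding set_add_def' using mspan_mono[of E "E \<union> F"] mspan_mono[of F "E \<union> F"]
    by (auto intro!: mspan_add)
  show "mspan (E \<union> F) \<subseteq> (mspan E :: 'k mpol set) <+>\<^bsub>mpol_ring V\<^esub> mspan F"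
  proof
    fix f :: "'k mpol" assume f: "f \<in> mspan (E \<union> F)"
    define g where "g = (\<Sum>t\<in>Poly_Mapping.keys f \<inter> E. Poly_Mapping.single t (Poly_Mapping.lookup f t))"
    define h where "h = (\<Sum>t\<in>Poly_Mapping.keys f - E. Poly_Mapping.single t (Poly_Mapping.lookup f t))"
    have *: "(\<Sum>t\<in>T. Poly_Mapping.single t (c t)) \<in> (mspan U :: 'k mpol set)" if "T \<subseteq> U" for T U c
      using that by (induction T rule: infinite_finite_induct) (auto intro!: mspan_add single_in_mspan)
    have "f = g + h"
      unfolding g_def h_def by (subst poly_sum_monomials[of f, symmetric])
         (rule sum.Int_Diff, simp)
    moreover have "g \<in> mspan E" "h \<in> mspan F"
      unfolding g_def h_def using f by (intro *; force simp: mspan_def)+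
    ultimately show "f \<in> mspan E <+>\<^bsub>mpol_ring V\<^esub> mspan F"
      unfolding set_add_def' by auto
  qed
qed

lemma ideal_prod_mspan:
  assumes "upset V E" "upset V F"
  shows "ideal_prod (mpol_ring V) (mspan E) (mspan F) = (mspan (msum E F) :: 'k::field mpol set)"
proof
  interpret R: cring "mpol_ring V :: 'k mpol ring" by (rule cring_mpol_ring)
  note id = ideal_mspan[OF assms(1), where 'k='k] ideal_mspan[OF assms(2), where 'k='k]
  show "ideal_prod (mpol_ring V) (mspan E) (mspan F) \<subseteq> (mspan (msum E F) :: 'k mpol set)"
  proof
    fix f :: "'k mpol" assume "f \<in> ideal_prod (mpol_ring V) (mspan E) (mspan F)"
    then show "f \<in> mspan (msum E F)"
      by induction (auto intro: mspan_mult mspan_add)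
  qed
  have "mspan (msum (msum E F) (expo V)) \<subseteq> ideal_prod (mpol_ring V) (mspan E) (mspan F :: 'k mpol set)"
  proof (rule mspan_subset_ideal[OF R.ideal_prod_is_ideal[OF id]])
    fix t assume "t \<in> msum E F"
    then obtain a b where "t = a + b" "a \<in> E" "b \<in> F" by (auto simp: msum_def)
    then have "monomial a \<otimes>\<^bsub>mpol_ring V\<^esub> monomial b \<in> ideal_prod (mpol_ring V) (mspan E) (mspan F :: 'k mpol set)"
      by (intro ideal_prod.prod) auto
    then show "monomial t \<in> ideal_prod (mpol_ring V) (mspan E) (mspan F :: 'k mpol set)"
      by (simp add: mult_single \<open>t = a + b\<close>)
  qed
  then show "mspan (msum E F) \<subseteq> ideal_prod (mpol_ring V) (mspan E) (mspan F :: 'k mpol set)"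
    by (simp add: gen_upset[OF upset_msum[OF assms]])
qed

lemma ideal_power_mspan:
  assumes "upset V E"
  shows "ideal_power (mpol_ring V) (mspan E) s = (mspan (epow V E s) :: 'k::field mpol set)"
proof (induction s)
  case 0
  then show ?case by (simp add: ideals_set_def nat_pow_def carrier_mpol_ring)
next
  case (Suc s)
  have "ideal_power (mpol_ring V) (mspan E) (Suc s) =
    ideal_prod (mpol_ring V) (ideal_power (mpol_ring V) (mspan E) s) (mspan E :: 'k mpol set)"
    by (simp add: ideals_set_def nat_pow_def)
  with Suc show ?case by (simp add: ideal_prod_mspan[OF upset_epow[OF assms] assms])
qed

section \<open>Associated primes\<close>

text \<open>The least value of \<open>pdeg P\<close> on the terms of f is the order of f along the
  prime generated by the variables in P; \<open>keys_mult_min\<close> bounds this order for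
  products.\<close>

definition pdeg :: "nat set \<Rightarrow> (nat \<Rightarrow>\<^sub>0 nat) \<Rightarrow> nat" where
  "pdeg P t = (\<Sum>i\<in>P. Poly_Mapping.lookup t i)"

text \<open>The exponents of the prime ideal generated by the variables in P; \<open>P = {}\<close>
  gives the zero ideal.\<close>

definition meets :: "nat set \<Rightarrow> nat set \<Rightarrow> (nat \<Rightarrow>\<^sub>0 nat) set" where
  "meets V P = {t \<in> expo V. Poly_Mapping.keys t \<inter> P \<noteq> {}}"

text \<open>The sets of variables that generate a colon ideal \<open>K : x\<^sup>t\<close>, for \<open>K\<close> with set of exponents \<open>E\<close>.\<close>

definition ass_vars :: "nat set \<Rightarrow> (nat \<Rightarrow>\<^sub>0 nat) set \<Rightarrow> nat set set" where
  "ass_vars V E = {P. P \<subseteq> V \<and>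
     (\<exists>t\<in>expo V. \<forall>u\<in>expo V. u + t \<in> E \<longleftrightarrow> Poly_Mapping.keys u \<inter> P \<noteq> {})}"

section \<open>Degrees, and terms of a product that cannot cancel\<close>

lemma pdeg_add: "pdeg P (t + u) = pdeg P t + pdeg P u"
  by (simp add: pdeg_def lookup_add sum.distrib)

lemma pdeg_eq_0_iff: "finite P \<Longrightarrow> pdeg P t = 0 \<longleftrightarrow> Poly_Mapping.keys t \<inter> P = {}"
  by (auto simp: pdeg_def in_keys_iff)

lemma upset_meets: "upset V (meets V P)"
  by (auto simp: upset_def meets_def keys_add_nat)

text \<open>Only one pair of terms contributes to this coefficient, so nothing cancels. It is
  applied at extreme terms: the least ones for a degree in \<open>keys_mult_min\<close>, and in
  \<open>leading_monomial_power\<close> the largest one outside E.\<close>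

lemma lookup_mult_unique:
  fixes f g :: "'k::field mpol"
  assumes "a \<in> Poly_Mapping.keys f" "b \<in> Poly_Mapping.keys g"
    and "\<And>a' b'. a' \<in> Poly_Mapping.keys f \<Longrightarrow> b' \<in> Poly_Mapping.keys g \<Longrightarrow> a' + b' = a + b
      \<Longrightarrow> a' = a \<and> b' = b"
  shows "Poly_Mapping.lookup (f * g) (a + b) = Poly_Mapping.lookup f a * Poly_Mapping.lookup g b"
proof -
  let ?c = "\<lambda>a' b'. Poly_Mapping.lookup f a' * Poly_Mapping.lookup g b'"
  have "f * g = (\<Sum>a'\<in>Poly_Mapping.keys f. Poly_Mapping.single a' (Poly_Mapping.lookup f a')) *
      (\<Sum>b'\<in>Poly_Mapping.keys g. Poly_Mapping.single b' (Poly_Mapping.lookup g b'))"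
    by (simp add: poly_sum_monomials)
  also have "\<dots> = (\<Sum>a'\<in>Poly_Mapping.keys f. \<Sum>b'\<in>Poly_Mapping.keys g. Poly_Mapping.single (a' + b') (?c a' b'))"
    by (simp add: sum_product mult_single)
  finally have "Poly_Mapping.lookup (f * g) (a + b) =
      (\<Sum>a'\<in>Poly_Mapping.keys f. \<Sum>b'\<in>Poly_Mapping.keys g. (?c a' b' when a' + b' = a + b))"
    by (simp add: lookup_sum lookup_single)
  also have "\<dots> = (\<Sum>a'\<in>Poly_Mapping.keys f. \<Sum>b'\<in>Poly_Mapping.keys g.
      (if b' = b then if a' = a then ?c a' b' else 0 else 0))"
    by (intro sum.cong refl) (use assms(3) in \<open>auto simp: when_def\<close>)
  also have "\<dots> = ?c a b"
    using assms(1,2) by (simp add: sum.delta)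
  finally show ?thesis .
qed

lemma keys_mult_monomial:
  fixes f :: "'k::field mpol"
  shows "Poly_Mapping.keys (f * monomial t) = (\<lambda>u. u + t) ` Poly_Mapping.keys f"
proof
  show "Poly_Mapping.keys (f * monomial t) \<subseteq> (\<lambda>u. u + t) ` Poly_Mapping.keys f"
    using keys_mult[of f "monomial t"] by auto
  show "(\<lambda>u. u + t) ` Poly_Mapping.keys f \<subseteq> Poly_Mapping.keys (f * monomial t)"
  proof
    fix v assume "v \<in> (\<lambda>u. u + t) ` Poly_Mapping.keys f"
    then obtain u where u: "v = u + t" "u \<in> Poly_Mapping.keys f" by auto
    have "Poly_Mapping.lookup (f * monomial t) (u + t) = Poly_Mapping.lookup f u * Poly_Mapping.lookup (monomial t :: 'k mpol) t"
      by (rule lookup_mult_unique) (use u in auto)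
    then show "v \<in> Poly_Mapping.keys (f * monomial t)"
      using u by (simp add: in_keys_iff)
  qed
qed

text \<open>Ties under \<open>\<phi>\<close> are broken by the linear order. With
  \<open>pdeg P\<close> alone several terms could be minimal and cancel in a product.\<close>

lemma finite_lex_min:
  fixes \<phi> :: "'a::linorder \<Rightarrow> nat"
  assumes "finite A" "A \<noteq> {}"
  obtains a where "a \<in> A" "\<And>b. b \<in> A \<Longrightarrow> \<phi> a \<le> \<phi> b" "\<And>b. b \<in> A \<Longrightarrow> \<phi> b = \<phi> a \<Longrightarrow> a \<le> b"
proof -
  let ?B = "{a \<in> A. \<phi> a = Min (\<phi> ` A)}"
  have "Min (\<phi> ` A) \<in> \<phi> ` A" using assms by simp
  then have "?B \<noteq> {}" by auto
  then have "Min ?B \<in> ?B" using assms(1) by (intro Min_in) auto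
  moreover have "\<And>b. b \<in> ?B \<Longrightarrow> Min ?B \<le> b" using assms(1) by simp
  moreover have "\<And>b. b \<in> A \<Longrightarrow> Min (\<phi> ` A) \<le> \<phi> b" using assms by simp
  ultimately show ?thesis using that[of "Min ?B"] by simp
qed

text \<open>The sum of the two least exponents, for \<open>pdeg P\<close> refined by the order on
  exponents, decomposes in only one way, so that term of the product survives. In degree 0 this
  makes P prime; in general it makes the powers of P primary.\<close>

lemma keys_mult_min:
  fixes f g :: "'k::field mpol"
  assumes "a \<in> Poly_Mapping.keys f" "b \<in> Poly_Mapping.keys g"
  obtains c where "c \<in> Poly_Mapping.keys (f * g)" "pdeg P c \<le> pdeg P a + pdeg P b"
proof -
  obtain a0 where a0: "a0 \<in> Poly_Mapping.keys f" "\<And>b. b \<in> Poly_Mapping.keys f \<Longrightarrow> pdeg P a0 \<le> pdeg P b"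
      "\<And>b. b \<in> Poly_Mapping.keys f \<Longrightarrow> pdeg P b = pdeg P a0 \<Longrightarrow> a0 \<le> b"
    by (rule finite_lex_min[of "Poly_Mapping.keys f" "pdeg P"]) (use assms(1) in auto)
  obtain b0 where b0: "b0 \<in> Poly_Mapping.keys g" "\<And>b. b \<in> Poly_Mapping.keys g \<Longrightarrow> pdeg P b0 \<le> pdeg P b"
      "\<And>b. b \<in> Poly_Mapping.keys g \<Longrightarrow> pdeg P b = pdeg P b0 \<Longrightarrow> b0 \<le> b"
    by (rule finite_lex_min[of "Poly_Mapping.keys g" "pdeg P"]) (use assms(2) in auto)
  have "Poly_Mapping.lookup (f * g) (a0 + b0) = Poly_Mapping.lookup f a0 * Poly_Mapping.lookup g b0"
  proof (rule lookup_mult_unique)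
    fix a' b' assume *: "a' \<in> Poly_Mapping.keys f" "b' \<in> Poly_Mapping.keys g" "a' + b' = a0 + b0"
    \<comment> \<open>Both degrees are at least the minimal ones and the totals agree, so each is
      minimal and the tie-breaking order applies. The sums being equal, neither inequality can then
      be strict.\<close>
    have "pdeg P a' + pdeg P b' = pdeg P a0 + pdeg P b0"
      using *(3) by (metis pdeg_add)
    with a0(2)[OF *(1)] b0(2)[OF *(2)] have "a0 \<le> a'" "b0 \<le> b'"
      using * by (auto intro: a0(3) b0(3))
    then show "a' = a0 \<and> b' = b0"
      using *(3) by (metis add_less_le_mono add_le_less_mono order.not_eq_order_implies_strict order_less_irrefl)
  qed (use a0 b0 in auto)
  then have "a0 + b0 \<in> Poly_Mapping.keys (f * g)"
    using a0(1) b0(1) by (simp add: in_keys_iff)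
  moreover have "pdeg P (a0 + b0) \<le> pdeg P a + pdeg P b"
    using a0(2) b0(2) assms by (simp add: pdeg_add add_mono)
  ultimately show ?thesis using that by blast
qed

text \<open>Each multiplication of f by the leading monomial of g moves at least one term of f into
  E and loses none that is already there, so the number of terms outside E decreases until f is in
  the ideal.\<close>

lemma leading_monomial_power:
  fixes f g :: "'k::field mpol"
  assumes "upset V E" "g \<in> mspan (expo V)" "g \<noteq> 0" "f \<in> mspan (expo V)" "g * f \<in> mspan E"
  shows "\<exists>r. monomial (Max (Poly_Mapping.keys g)) ^ r * f \<in> mspan E"
  using assms(4,5)
proof (induction "card (Poly_Mapping.keys f - E)" arbitrary: f rule: less_induct)
  case less
  show ?case
  proof (cases "Poly_Mapping.keys f \<subseteq> E")
    case True
    then have "monomial (Max (Poly_Mapping.keys g)) ^ 0 * f \<in> mspan E" by (simp add: mspan_def)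
    then show ?thesis by blast
  next
    case False
    define b where "b = Max (Poly_Mapping.keys g)"
    \<comment> \<open>This is the largest exponent outside E, not the leading exponent of f: terms
      with exponents in E only produce exponents in E and cannot interfere.\<close>
    define t0 where "t0 = Max (Poly_Mapping.keys f - E)"
    have "Poly_Mapping.keys g \<noteq> {}" using assms(3) by (simp add: keys_eq_empty)
    then have b: "b \<in> Poly_Mapping.keys g" "\<And>b'. b' \<in> Poly_Mapping.keys g \<Longrightarrow> b' \<le> b"
      unfolding b_def by auto
    have "t0 \<in> Poly_Mapping.keys f - E" unfolding t0_def using False by (intro Max_in) auto
    then have t0: "t0 \<in> Poly_Mapping.keys f" "t0 \<notin> E" by auto
    have t0_max: "t \<le> t0" if "t \<in> Poly_Mapping.keys f" "t \<notin> E" for t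
      unfolding t0_def using that by simp
    have bV: "b \<in> expo V" using b assms(2) by (auto simp: mspan_def)
    have gV: "b' \<in> expo V" if "b' \<in> Poly_Mapping.keys g" for b' using that assms(2) by (auto simp: mspan_def)
    have "b + t0 \<in> E"
    proof (rule ccontr)
      assume nE: "b + t0 \<notin> E"
      have "Poly_Mapping.lookup (g * f) (b + t0) = Poly_Mapping.lookup g b * Poly_Mapping.lookup f t0"
      proof (rule lookup_mult_unique)
        fix b' t' assume *: "b' \<in> Poly_Mapping.keys g" "t' \<in> Poly_Mapping.keys f" "b' + t' = b + t0"
        \<comment> \<open>Otherwise up-closure would put b' + t', which equals b + t0, into
          E.\<close>
        have "t' \<notin> E" using upsetD'[OF assms(1) _ gV[OF *(1)]] *(3) nE by metis
        then have "t' \<le> t0" using t0_max * by blast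
        then show "b' = b \<and> t' = t0"
          using *(3) b(2)[OF *(1)]
          by (metis add_less_le_mono add_le_less_mono order.not_eq_order_implies_strict order_less_irrefl)
      qed (use b t0 in auto)
      then have "b + t0 \<in> Poly_Mapping.keys (g * f)" using b t0 by (simp add: in_keys_iff)
      with nE less.prems(2) show False by (auto simp: mspan_def)
    qed
    define f' where "f' = monomial b * f"
    have keys_f': "Poly_Mapping.keys f' = (\<lambda>u. u + b) ` Poly_Mapping.keys f"
      unfolding f'_def by (simp add: mult.commute keys_mult_monomial)
    \<comment> \<open>Terms of the new polynomial outside E come from terms of f outside E, and t0
      is no longer among them.\<close>
    have "Poly_Mapping.keys f' - E \<subseteq> (\<lambda>u. u + b) ` (Poly_Mapping.keys f - E - {t0})"
    proof
      fix t assume "t \<in> Poly_Mapping.keys f' - E"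
      then obtain u where u: "t = u + b" "u \<in> Poly_Mapping.keys f" "t \<notin> E" by (auto simp: keys_f')
      then have "u \<notin> E" "u \<noteq> t0" using upsetD[OF assms(1) _ bV, of u] \<open>b + t0 \<in> E\<close> by (auto simp: add.commute)
      then show "t \<in> (\<lambda>u. u + b) ` (Poly_Mapping.keys f - E - {t0})" using u by auto
    qed
    then have "card (Poly_Mapping.keys f' - E) \<le> card (Poly_Mapping.keys f - E - {t0})"
      by (intro surj_card_le) auto
    also have "\<dots> < card (Poly_Mapping.keys f - E)"
      using t0 by (intro psubset_card_mono) auto
    finally have less': "card (Poly_Mapping.keys f' - E) < card (Poly_Mapping.keys f - E)" .
    have "f' \<in> mspan (expo V)" using less.prems(1) bV by (auto simp: mspan_def keys_f')
    moreover have gf': "g * f' = g * f * monomial b" by (simp add: f'_def ac_simps)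
    then have "g * f' \<in> mspan E"
      using less.prems(2) upsetD[OF assms(1) _ bV] unfolding gf'
      by (auto simp: mspan_def keys_mult_monomial)
    ultimately obtain r where "monomial b ^ r * f' \<in> mspan E"
      using less.hyps[OF less'] unfolding b_def by blast
    then have "monomial b ^ Suc r * f \<in> mspan E" by (simp add: f'_def ac_simps)
    then show ?thesis unfolding b_def by blast
  qed
qed

lemma monomial_power_mspan: "b \<in> expo V \<Longrightarrow> (monomial b :: 'k::field mpol) ^ r \<in> mspan (expo V)"
proof (induction r)
  case (Suc r)
  then show ?case by (auto simp: mspan_def mult.commute[of "monomial b"] keys_mult_monomial)
qed (simp add: mspan_def)

text \<open>Primeness turns the power of the leading monomial into the monomial itself. Subtracting
  the leading term of g stays in p, and induction on the number of terms handles the rest.\<close>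

lemma assoc_prime_monomials:
  fixes p :: "'k::field mpol set"
  assumes E: "upset V E" and p: "primeideal p (mpol_ring V)" and f: "f \<in> mspan (expo V)"
    and pf: "p = {g \<in> mspan (expo V). g * f \<in> mspan E}"
    and "g \<in> p" "t \<in> Poly_Mapping.keys g"
  shows "monomial t \<in> p"
  using assms(5,6)
proof (induction "card (Poly_Mapping.keys g)" arbitrary: g rule: less_induct)
  case less
  interpret p: primeideal p "mpol_ring V :: 'k mpol ring" by (rule p)
  have p_add: "a + b \<in> p" if "a \<in> p" "b \<in> p" for a b
    using additive_subgroup.a_closed[OF p.additive_subgroup_axioms that] by simp
  define b where "b = Max (Poly_Mapping.keys g)"
  have b: "b \<in> Poly_Mapping.keys g" unfolding b_def using less.prems by (intro Max_in) auto
  have gV: "g \<in> mspan (expo V)" and gf: "g * f \<in> mspan E" using less.prems(1) pf by auto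
  have bV: "b \<in> expo V" using b gV by (auto simp: mspan_def)
  have "g \<noteq> 0" using b by auto
  then obtain r where "monomial b ^ r * f \<in> mspan E"
    using leading_monomial_power[OF E gV _ f gf] unfolding b_def by blast
  then have "monomial b ^ r \<in> p" unfolding pf using monomial_power_mspan[OF bV] by blast
  then have bp: "monomial b \<in> p"
  proof (induction r)
    case 0
    then have "p = carrier (mpol_ring V)" using p.one_imp_carrier by simp
    then show ?case using p.I_notcarr by simp
  next
    case (Suc r)
    then have "monomial b \<in> p \<or> monomial b ^ r \<in> p"
      using p.I_prime[of "monomial b" "monomial b ^ r"] bV monomial_power_mspan[OF bV, of r, where 'k = 'k]
      unfolding carrier_mpol_ring by simp
    with Suc show ?case by blast
  qed
  have "Poly_Mapping.single b c \<in> p" for c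
  proof -
    have "Poly_Mapping.single 0 c * monomial b \<in> p"
      using p.I_l_closed[OF bp, of "Poly_Mapping.single 0 c"] by (simp add: carrier_mpol_ring single_in_mspan)
    then show ?thesis by (simp add: mult_single)
  qed
  from p_add[OF less.prems(1) this[of "- Poly_Mapping.lookup g b"]]
  have g': "g + Poly_Mapping.single b (- Poly_Mapping.lookup g b) \<in> p" (is "?g \<in> p") .
  have kg': "Poly_Mapping.keys ?g = Poly_Mapping.keys g - {b}"
    by (auto simp: in_keys_iff lookup_add lookup_single when_def split: if_splits)
  show ?case
  proof (cases "t = b")
    case False
    have "card (Poly_Mapping.keys ?g) < card (Poly_Mapping.keys g)"
      unfolding kg' using b by (intro psubset_card_mono) auto
    from less.hyps[OF this g'] show ?thesis using False less.prems(2) by (simp add: kg')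
  qed (use bp in simp)
qed

lemma monomial_in_prime:
  fixes p :: "'k::field mpol set"
  assumes p: "primeideal p (mpol_ring V)" and "t \<in> expo V" "monomial t \<in> p"
  shows "\<exists>i\<in>Poly_Mapping.keys t. monomial (Poly_Mapping.single i 1) \<in> p"
proof -
  interpret p: primeideal p "mpol_ring V :: 'k mpol ring" by (rule p)
  from assms(2,3) show ?thesis
  \<comment> \<open>The measure is the total degree, taken over the support of t itself because V
    may be infinite. The support can shrink when a variable is split off, hence the two-step
    estimate below.\<close>
  proof (induction "pdeg (Poly_Mapping.keys t) t" arbitrary: t rule: less_induct)
    case less
    show ?case
    proof (cases "t = 0")
      case True
      then have "p = carrier (mpol_ring V)" using p.one_imp_carrier less.prems by simp
      then show ?thesis using p.I_notcarr by simp
    next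
      case False
      then have "Poly_Mapping.keys t \<noteq> {}" by simp
      then obtain i where i: "i \<in> Poly_Mapping.keys t" by blast
      define u where "u = t - Poly_Mapping.single i 1"
      have t: "t = Poly_Mapping.single i 1 + u"
        using i by (intro poly_mapping_eqI) (auto simp: u_def lookup_add lookup_minus lookup_single when_def in_keys_iff)
      have iV: "Poly_Mapping.single i 1 \<in> expo V" and uV: "u \<in> expo V"
        using less.prems(1) unfolding t by auto
      have "monomial (Poly_Mapping.single i 1) \<in> p \<or> monomial u \<in> p"
        using p.I_prime[of "monomial (Poly_Mapping.single i 1)" "monomial u"] less.prems(2) iV uV
        by (simp add: carrier_mpol_ring mult_single t)
      moreover have ?thesis if "monomial u \<in> p"
      proof -
        have sub: "Poly_Mapping.keys u \<subseteq> Poly_Mapping.keys t" unfolding t by (auto simp: keys_add_nat)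
        have "pdeg (Poly_Mapping.keys u) u \<le> pdeg (Poly_Mapping.keys t) u"
          unfolding pdeg_def by (rule sum_mono2) (use sub in auto)
        also have "\<dots> < pdeg (Poly_Mapping.keys t) t"
          using i pdeg_add[of "Poly_Mapping.keys t" "Poly_Mapping.single i 1" u, folded t]
            pdeg_eq_0_iff[of "Poly_Mapping.keys t" "Poly_Mapping.single i 1"] by simp
        finally show ?thesis using less.hyps[OF _ uV that] sub by blast
      qed
      ultimately show ?thesis using i by blast
    qed
  qed
qed

text \<open>Two polynomials outside the ideal both have a term of P-degree 0; by
  \<open>keys_mult_min\<close> so does their product.\<close>

lemma primeideal_meets:
  assumes "finite P" "P \<subseteq> V"
  shows "primeideal (mspan (meets V P) :: 'k::field mpol set) (mpol_ring V)"
proof (rule primeidealI[OF ideal_mspan[OF upset_meets] cring_mpol_ring])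
  show "carrier (mpol_ring V) \<noteq> (mspan (meets V P) :: 'k mpol set)"
  proof -
    have "0 \<in> expo V" "0 \<notin> meets V P" by (simp_all add: meets_def)
    then show ?thesis unfolding carrier_mpol_ring mspan_eq_iff by blast
  qed
  fix f g :: "'k mpol"
  assume fg: "f \<in> carrier (mpol_ring V)" "g \<in> carrier (mpol_ring V)" "f \<otimes>\<^bsub>mpol_ring V\<^esub> g \<in> mspan (meets V P)"
  show "f \<in> mspan (meets V P) \<or> g \<in> mspan (meets V P)"
  proof (rule ccontr)
    assume "\<not> ?thesis"
    then obtain a b where ab: "a \<in> Poly_Mapping.keys f" "a \<notin> meets V P" "b \<in> Poly_Mapping.keys g" "b \<notin> meets V P"
      by (auto simp: mspan_def)
    then have "pdeg P a = 0" "pdeg P b = 0"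
      using fg(1,2) assms(1) by (auto simp: meets_def carrier_mpol_ring mspan_def pdeg_eq_0_iff)
    then obtain c where "c \<in> Poly_Mapping.keys (f * g)" "pdeg P c = 0"
      using keys_mult_min[OF ab(1,3), of P] by auto
    then show False using fg(3) assms(1) by (auto simp: mspan_def meets_def pdeg_eq_0_iff)
  qed
qed

text \<open>The point of the hard inclusion is that the annihilated element, a polynomial f, can be
  replaced by one of its monomials.\<close>

lemma assoc_primes_mspan:
  assumes "finite V" "upset V E"
  shows "assoc_primes (mpol_ring V) (mspan E :: 'k::field mpol set) = (\<lambda>P. mspan (meets V P)) ` ass_vars V E"
proof
  show "(\<lambda>P. mspan (meets V P)) ` ass_vars V E \<subseteq> assoc_primes (mpol_ring V) (mspan E :: 'k mpol set)"
  proof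
    fix p :: "'k mpol set" assume "p \<in> (\<lambda>P. mspan (meets V P)) ` ass_vars V E"
    then obtain P t where P: "p = mspan (meets V P)" "P \<subseteq> V" "t \<in> expo V"
      "\<And>u. u \<in> expo V \<Longrightarrow> u + t \<in> E \<longleftrightarrow> Poly_Mapping.keys u \<inter> P \<noteq> {}"
      by (auto simp: ass_vars_def)
    have "primeideal p (mpol_ring V)"
      unfolding P(1) using P(2) assms(1) by (intro primeideal_meets) (auto intro: finite_subset)
    moreover have "p = {g \<in> mspan (expo V). g * monomial t \<in> mspan E}"
    proof (rule Set.set_eqI)
      fix g :: "'k mpol"
      show "g \<in> p \<longleftrightarrow> g \<in> {g \<in> mspan (expo V). g * monomial t \<in> mspan E}"
        using P(4) by (auto simp: P(1) mspan_def meets_def keys_mult_monomial subset_iff)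
    qed
    ultimately show "p \<in> assoc_primes (mpol_ring V) (mspan E :: 'k mpol set)"
      using P(3) unfolding assoc_primes_def by (auto simp: carrier_mpol_ring intro!: bexI[of _ "monomial t"])
  qed
  show "assoc_primes (mpol_ring V) (mspan E :: 'k mpol set) \<subseteq> (\<lambda>P. mspan (meets V P)) ` ass_vars V E"
  proof
    fix p assume "p \<in> assoc_primes (mpol_ring V) (mspan E :: 'k mpol set)"
    then obtain f where p: "primeideal p (mpol_ring V)" and f: "f \<in> mspan (expo V)"
      and pf: "p = {g \<in> mspan (expo V). g * f \<in> mspan E}"
      unfolding assoc_primes_def by (auto simp: carrier_mpol_ring)
    interpret p: primeideal p "mpol_ring V :: 'k mpol ring" by (rule p)
    define P where "P = {i \<in> V. monomial (Poly_Mapping.single i 1) \<in> p}"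
    have mono: "monomial u \<in> p \<longleftrightarrow> Poly_Mapping.keys u \<inter> P \<noteq> {}" if u: "u \<in> expo V" for u
    proof
      assume "monomial u \<in> p"
      from monomial_in_prime[OF p u this] u show "Poly_Mapping.keys u \<inter> P \<noteq> {}"
        by (auto simp: P_def expo_def)
    next
      assume "Poly_Mapping.keys u \<inter> P \<noteq> {}"
      then obtain i where i: "i \<in> Poly_Mapping.keys u" "monomial (Poly_Mapping.single i 1) \<in> p"
        by (auto simp: P_def)
      have "u = (u - Poly_Mapping.single i 1) + Poly_Mapping.single i 1"
        using i by (intro poly_mapping_eqI) (auto simp: lookup_add lookup_minus lookup_single when_def in_keys_iff)
      moreover from this have "u - Poly_Mapping.single i 1 \<in> expo V" using u by (metis expo_add)
      ultimately show "monomial u \<in> p"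
        using p.I_l_closed[OF i(2), of "monomial (u - Poly_Mapping.single i 1)"]
        by (simp add: carrier_mpol_ring mult_single)
    qed
    have p_eq: "p = mspan (meets V P)"
    proof
      show "p \<subseteq> mspan (meets V P)"
      proof
        fix g assume g: "g \<in> p"
        then have "g \<in> mspan (expo V)" using pf by auto
        moreover have "monomial t \<in> p" if "t \<in> Poly_Mapping.keys g" for t
          by (rule assoc_prime_monomials[OF assms(2) p f pf g that])
        ultimately show "g \<in> mspan (meets V P)" using mono by (auto simp: mspan_def meets_def)
      qed
      have "mspan (msum (meets V P) (expo V)) \<subseteq> p"
        by (rule mspan_subset_ideal) (use mono p.is_ideal in \<open>auto simp: meets_def\<close>)
      then show "mspan (meets V P) \<subseteq> p" by (simp add: gen_upset[OF upset_meets])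
    qed
    \<comment> \<open>As E is spanned by monomials, p is the intersection of the colon ideals of the
      terms of f. A prime that is a finite intersection of ideals equals one of them.\<close>
    have "\<exists>t\<in>Poly_Mapping.keys f. \<forall>u\<in>expo V. u + t \<in> E \<longrightarrow> Poly_Mapping.keys u \<inter> P \<noteq> {}"
    proof (rule ccontr)
      assume "\<not> ?thesis"
      then obtain w where w: "\<And>t. t \<in> Poly_Mapping.keys f \<Longrightarrow> w t \<in> expo V \<and> w t + t \<in> E \<and> Poly_Mapping.keys (w t) \<inter> P = {}"
        by (auto simp: Bex_def Ball_def) metis
      \<comment> \<open>If every term t were sent into E by some w t avoiding P, the sum of all w t
        would still avoid P and would send every term of f into E, so its monomial would lie in
        p.\<close>
      define W where "W = (\<Sum>t\<in>Poly_Mapping.keys f. w t)"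
      have "sum w T \<in> expo V \<and> Poly_Mapping.keys (sum w T) \<inter> P = {}" if "T \<subseteq> Poly_Mapping.keys f" for T
        using that w by (induction T rule: infinite_finite_induct) (auto simp: keys_add_nat)
      then have W: "sum w T \<in> expo V" "Poly_Mapping.keys (sum w T) \<inter> P = {}" if "T \<subseteq> Poly_Mapping.keys f" for T
        using that by blast+
      have "W + t \<in> E" if t: "t \<in> Poly_Mapping.keys f" for t
      proof -
        have "W = w t + sum w (Poly_Mapping.keys f - {t})"
          unfolding W_def using t by (simp add: sum.remove)
        then have "W + t = (w t + t) + sum w (Poly_Mapping.keys f - {t})" by (simp add: ac_simps)
        then show ?thesis using upsetD[OF assms(2)] w[OF t] W(1)[of "Poly_Mapping.keys f - {t}"] by auto
      qed
      then have "f * monomial W \<in> mspan E" by (auto simp: mspan_def keys_mult_monomial add.commute)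
      then have "monomial W \<in> p" unfolding pf using W(1) by (simp add: W_def mult.commute)
      then show False using mono W unfolding W_def by blast
    qed
    then obtain t where t: "t \<in> Poly_Mapping.keys f"
      "\<And>u. u \<in> expo V \<Longrightarrow> u + t \<in> E \<Longrightarrow> Poly_Mapping.keys u \<inter> P \<noteq> {}" by blast
    have "u + t \<in> E" if u: "u \<in> expo V" "Poly_Mapping.keys u \<inter> P \<noteq> {}" for u
    proof -
      have "monomial u * f \<in> mspan E" using mono u pf by blast
      then show ?thesis using t(1) by (auto simp: mspan_def mult.commute[of "monomial u"] keys_mult_monomial add.commute)
    qed
    then have "P \<in> ass_vars V E"
      unfolding ass_vars_def using t f by (auto simp: P_def mspan_def intro!: bexI[of _ t])
    then show "p \<in> (\<lambda>P. mspan (meets V P)) ` ass_vars V E" using p_eq by blast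
  qed
qed

section \<open>Symbolic powers\<close>

text \<open>Splits off one variable of P. It drives the computation of powers of a prime and, later,
  the pairing of variables in mn.\<close>

lemma pdeg_Suc_split:
  assumes "finite P" "Suc s \<le> pdeg P t"
  obtains u v where "t = u + v" "s \<le> pdeg P u" "Poly_Mapping.keys v \<inter> P \<noteq> {}"
proof -
  have "Poly_Mapping.keys t \<inter> P \<noteq> {}"
    using assms(2) by (simp add: pdeg_eq_0_iff[OF assms(1), symmetric])
  then obtain i where i: "i \<in> Poly_Mapping.keys t" "i \<in> P" by blast
  have t: "t = (t - Poly_Mapping.single i 1) + Poly_Mapping.single i 1"
    using i by (intro poly_mapping_eqI) (auto simp: lookup_add lookup_minus lookup_single when_def in_keys_iff)
  have "pdeg P (Poly_Mapping.single i 1) = 1"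
    using i assms(1) by (simp add: pdeg_def lookup_single when_def)
  then have "s \<le> pdeg P (t - Poly_Mapping.single i 1)"
    using assms(2) pdeg_add[of P "t - Poly_Mapping.single i 1" "Poly_Mapping.single i 1"]
    by (simp only: t[symmetric])
  then show ?thesis using that[OF t] i by simp
qed

lemma epow_meets:
  assumes "finite P" "P \<subseteq> V"
  shows "epow V (meets V P) s = {t \<in> expo V. s \<le> pdeg P t}"
proof (induction s)
  case (Suc s)
  show ?case
  proof (intro Set.set_eqI iffI)
    fix t assume "t \<in> epow V (meets V P) (Suc s)"
    then obtain u v where uv: "t = u + v" "u \<in> expo V" "s \<le> pdeg P u" "v \<in> meets V P"
      by (auto simp: Suc msum_def)
    then have "v \<in> expo V" "pdeg P v \<noteq> 0" using pdeg_eq_0_iff[OF assms(1), of v] by (auto simp: meets_def)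
    then show "t \<in> {t \<in> expo V. Suc s \<le> pdeg P t}" using uv by (simp add: pdeg_add)
  next
    fix t assume t: "t \<in> {t \<in> expo V. Suc s \<le> pdeg P t}"
    then obtain u v where uv: "t = u + v" "s \<le> pdeg P u" "Poly_Mapping.keys v \<inter> P \<noteq> {}"
      using pdeg_Suc_split[OF assms(1)] by blast
    then have "u \<in> {t \<in> expo V. s \<le> pdeg P t}" "v \<in> meets V P" using t by (auto simp: meets_def)
    then show "t \<in> epow V (meets V P) (Suc s)" using uv by (auto simp: Suc msum_def)
  qed
qed simp

section \<open>Localizations inside the fraction field\<close>

lemma emb_add: "emb (f + g) = emb f + emb g" by simp
lemma emb_mult: "emb (f * g) = emb f * emb g" by simp
lemma emb_uminus: "emb (- f) = - emb f" by simp
lemma emb_eq_iff: "emb f = emb g \<longleftrightarrow> f = g" by (simp add: eq_fract)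
lemma emb_0: "emb 0 = 0" by (simp add: Zero_fract_def)
lemma emb_1: "emb 1 = 1" by (simp add: One_fract_def)
lemma emb_mult_Fract: "u \<noteq> 0 \<Longrightarrow> emb u * Fraction_Field.Fract f u = emb f"
  by (simp add: eq_fract mult.commute)

lemma cring_loc_prime:
  fixes p :: "'k::field mpol set"
  assumes p: "primeideal p (mpol_ring V)"
  shows "cring (loc_prime V p)"
  unfolding loc_prime_def
proof (rule cring_class_subring)
  interpret p: primeideal p "mpol_ring V :: 'k mpol ring" by (rule p)
  let ?R = "carrier (mpol_ring V) :: 'k mpol set"
  let ?C = "{Fraction_Field.Fract f u |f u. f \<in> ?R \<and> u \<in> ?R - p}"
  have nz: "u \<noteq> 0" if "u \<in> ?R - p" for u
    using that additive_subgroup.zero_closed[OF p.additive_subgroup_axioms] by auto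
  have mult: "f * g \<in> ?R" and add: "f + g \<in> ?R" if "f \<in> ?R" "g \<in> ?R" for f g
    using p.m_closed[OF that] p.a_closed[OF that] by simp_all
  have mult': "u * v \<in> ?R - p" if "u \<in> ?R - p" "v \<in> ?R - p" for u v
    using mult p.I_prime[of u v] that by auto
  have "1 \<notin> p" using p.one_imp_carrier p.I_notcarr by auto
  then have one: "1 \<in> ?R - p" "1 \<in> ?R" using p.one_closed by simp_all
  have "1 = Fraction_Field.Fract (1 :: 'k mpol) 1" by (rule One_fract_def)
  with one show "1 \<in> ?C" by blast
  fix x y assume "x \<in> ?C" "y \<in> ?C"
  then obtain f u g v where xy: "x = Fraction_Field.Fract f u" "y = Fraction_Field.Fract g v"
    "f \<in> ?R" "u \<in> ?R - p" "g \<in> ?R" "v \<in> ?R - p" by blast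
  note nz' = nz[OF xy(4)] nz[OF xy(6)]
  have "- f \<in> ?R" using xy(3) mspan_uminus by (simp add: carrier_mpol_ring)
  moreover have "- x = Fraction_Field.Fract (- f) u" by (simp add: xy)
  ultimately show "- x \<in> ?C" using xy(4) by blast
  have "x + y = Fraction_Field.Fract (f * v + g * u) (u * v)" using nz' by (simp add: xy)
  moreover have "f * v + g * u \<in> ?R" using xy by (intro add mult) auto
  ultimately show "x + y \<in> ?C" using mult'[OF xy(4,6)] by blast
  have "x * y = Fraction_Field.Fract (f * g) (u * v)" by (simp add: xy)
  moreover have "f * g \<in> ?R" using xy by (intro mult) auto
  ultimately show "x * y \<in> ?C" using mult'[OF xy(4,6)] by blast
qed

text \<open>The elements of C that some u in U carries into Q form an ideal of C containing Q, hence
  contain the generated ideal. U is the complement of p for \<open>loc_prime\<close>, and the set of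
  monomials in W for \<open>loc_vars\<close>.\<close>

lemma Idl_localization_denominator:
  fixes C :: "'k::field mpol fract set" and U Q :: "'k mpol set"
  assumes C: "cring (class_subring C)" and R: "emb ` carrier (mpol_ring V) \<subseteq> C"
    and U: "U \<subseteq> carrier (mpol_ring V)" "1 \<in> U" "\<And>u v. u \<in> U \<Longrightarrow> v \<in> U \<Longrightarrow> u * v \<in> U"
    and denom: "\<And>z. z \<in> C \<Longrightarrow> \<exists>u\<in>U. emb u * z \<in> emb ` carrier (mpol_ring V)"
    and Q: "ideal Q (mpol_ring V)" and z: "z \<in> Idl\<^bsub>class_subring C\<^esub> (emb ` Q)"
  shows "\<exists>u\<in>U. emb u * z \<in> emb ` Q"
proof -
  interpret Q: ideal Q "mpol_ring V :: 'k mpol ring" by (rule Q)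
  interpret C: cring "class_subring C" by (rule C)
  let ?R = "carrier (mpol_ring V) :: 'k mpol set"
  let ?J = "{z \<in> C. \<exists>u\<in>U. emb u * z \<in> emb ` Q}"
  have Qmult: "f * g \<in> Q" if "f \<in> ?R" "g \<in> Q" for f g
    using Q.I_l_closed[OF that(2,1)] by simp
  have Qadd: "f + g \<in> Q" if "f \<in> Q" "g \<in> Q" for f g
    using additive_subgroup.a_closed[OF Q.additive_subgroup_axioms that] by simp
  have Q0: "0 \<in> Q" using additive_subgroup.zero_closed[OF Q.additive_subgroup_axioms] by simp
  have C0: "0 \<in> C" using C.zero_closed by (simp add: cring_class_ops_def)
  have C_add: "x + y \<in> C" and C_mult: "x * y \<in> C" if "x \<in> C" "y \<in> C" for x y
    using C.a_closed[of x y] C.m_closed[of x y] that by (simp_all add: cring_class_ops_def)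
  have "ideal ?J (class_subring C)"
  proof (rule ideal_class_subringI[OF C])
    have "emb 1 * 0 = emb 0" by (simp only: emb_0 mult_zero_right)
    then have "emb 1 * 0 \<in> emb ` Q" using Q0 by (rule image_eqI)
    then show "0 \<in> ?J" using U(2) C0 by blast
    fix x y assume "x \<in> ?J" "y \<in> ?J"
    then obtain u v f g where *: "x \<in> C" "y \<in> C" "u \<in> U" "v \<in> U" "emb u * x = emb f"
      "emb v * y = emb g" "f \<in> Q" "g \<in> Q" by blast
    \<comment> \<open>Two fractions are brought to the common denominator u v.\<close>
    have "emb (u * v) * (x + y) = emb v * (emb u * x) + emb u * (emb v * y)"
      unfolding emb_mult by (simp only: algebra_simps)
    also have "\<dots> = emb (v * f + u * g)" by (simp only: * emb_mult emb_add)
    finally have "emb (u * v) * (x + y) = emb (v * f + u * g)" .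
    moreover have "v * f + u * g \<in> Q" by (intro Qadd Qmult subsetD[OF U(1)] *)
    ultimately have "emb (u * v) * (x + y) \<in> emb ` Q" by (rule image_eqI)
    then show "x + y \<in> ?J" using C_add[OF *(1,2)] U(3)[OF *(3,4)] by blast
  next
    fix c x assume "c \<in> C" "x \<in> ?J"
    then obtain u f where *: "x \<in> C" "c \<in> C" "u \<in> U" "emb u * x = emb f" "f \<in> Q" by blast
    obtain v g where v: "v \<in> U" "g \<in> ?R" "emb v * c = emb g" using denom[OF *(2)] by blast
    have "emb (v * u) * (c * x) = (emb v * c) * (emb u * x)" unfolding emb_mult by (simp only: ac_simps)
    also have "\<dots> = emb (g * f)" by (simp only: * v emb_mult)
    finally have "emb (v * u) * (c * x) = emb (g * f)" .
    then have "emb (v * u) * (c * x) \<in> emb ` Q" using Qmult[OF v(2) *(5)] by (rule image_eqI)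
    then show "c * x \<in> ?J" using C_mult[OF *(2,1)] U(3)[OF v(1) *(3)] by blast
  qed auto
  moreover have "emb ` Q \<subseteq> ?J"
  proof
    fix z assume "z \<in> emb ` Q"
    then obtain f where f: "z = emb f" "f \<in> Q" by blast
    then have "emb 1 * z \<in> emb ` Q" by (simp only: emb_1 mult_1_left image_eqI)
    then show "z \<in> ?J" using R Q.Icarr[OF f(2)] U(2) f(1) by blast
  qed
  ultimately have "Idl\<^bsub>class_subring C\<^esub> (emb ` Q) \<subseteq> ?J" by (rule C.genideal_minimal)
  then show ?thesis using z by blast
qed

lemma Idl_loc_prime_denominator:
  fixes p Q :: "'k::field mpol set"
  assumes p: "primeideal p (mpol_ring V)" and Q: "ideal Q (mpol_ring V)"
    and z: "z \<in> Idl\<^bsub>loc_prime V p\<^esub> (emb ` Q)"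
  shows "\<exists>u\<in>carrier (mpol_ring V) - p. emb u * z \<in> emb ` Q"
proof -
  interpret p: primeideal p "mpol_ring V :: 'k mpol ring" by (rule p)
  let ?R = "carrier (mpol_ring V) :: 'k mpol set"
  have nz: "u \<noteq> 0" if "u \<in> ?R - p" for u
    using that additive_subgroup.zero_closed[OF p.additive_subgroup_axioms] by auto
  have mult: "u * v \<in> ?R - p" if "u \<in> ?R - p" "v \<in> ?R - p" for u v
    using p.m_closed[of u v] p.I_prime[of u v] that by auto
  have "1 \<notin> p" using p.one_imp_carrier p.I_notcarr by auto
  then have one: "1 \<in> ?R - p" using p.one_closed by simp
  show ?thesis
  proof (rule Idl_localization_denominator[OF cring_loc_prime[OF p, unfolded loc_prime_def] _ _ one mult _ Q
        z[unfolded loc_prime_def]])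
    fix z assume "z \<in> {Fraction_Field.Fract f u |f u. f \<in> ?R \<and> u \<in> ?R - p}"
    then obtain f u where fu: "z = Fraction_Field.Fract f u" "f \<in> ?R" "u \<in> ?R - p" by blast
    then have "emb u * z = emb f" using emb_mult_Fract nz by blast
    then show "\<exists>u\<in>?R - p. emb u * z \<in> emb ` ?R" using fu by blast
  qed (use one in auto)
qed

text \<open>A term of u of P-degree 0 and a term of f of degree below s would force, by
  \<open>keys_mult_min\<close>, a term of u f of degree below s.\<close>

lemma mspan_primary:
  fixes f u :: "'k::field mpol"
  assumes "finite P" "u \<in> mspan (expo V)" "u \<notin> mspan (meets V P)" "f \<in> mspan (expo V)"
    and "u * f \<in> mspan {t \<in> expo V. s \<le> pdeg P t}"
  shows "f \<in> mspan {t \<in> expo V. s \<le> pdeg P t}"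
proof (rule ccontr)
  assume "\<not> ?thesis"
  then obtain b where b: "b \<in> Poly_Mapping.keys f" "pdeg P b < s"
    using assms(4) by (auto simp: mspan_def subset_iff not_le)
  obtain a where a: "a \<in> Poly_Mapping.keys u" "a \<notin> meets V P" using assms(3) by (auto simp: mspan_def)
  then have "pdeg P a = 0" using assms(1,2) by (auto simp: mspan_def meets_def pdeg_eq_0_iff)
  then obtain c where "c \<in> Poly_Mapping.keys (u * f)" "pdeg P c \<le> pdeg P b"
    using keys_mult_min[OF a(1) b(1), of P] by auto
  then show False using assms(5) b(2) by (auto simp: mspan_def)
qed

text \<open>Membership in p^s R_p yields a denominator u outside p, and \<open>mspan_primary\<close>
  removes it. For the unit ideal there are no associated primes and the formula returns all of
  \<open>expo V\<close>.\<close>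

lemma symbolic_power_mspan:
  assumes "finite V" "upset V E"
  shows "symbolic_power V (mspan E) s =
    (mspan {t \<in> expo V. \<forall>P\<in>ass_vars V E. s \<le> pdeg P t} :: 'k::field mpol set)"
proof -
  have *: "emb f \<in> Idl\<^bsub>loc_prime V (mspan (meets V P))\<^esub> (emb ` ideal_power (mpol_ring V) (mspan (meets V P)) s)
      \<longleftrightarrow> f \<in> mspan {t \<in> expo V. s \<le> pdeg P t}"
    if P: "P \<in> ass_vars V E" and f: "f \<in> mspan (expo V)" for P and f :: "'k mpol"
  proof -
    have P': "finite P" "P \<subseteq> V" using P assms(1) by (auto simp: ass_vars_def intro: finite_subset)
    note prime = primeideal_meets[OF P', where 'k = 'k]
    let ?p = "mspan (meets V P) :: 'k mpol set"
    let ?Q = "mspan {t \<in> expo V. s \<le> pdeg P t} :: 'k mpol set"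
    have Q: "ideal_power (mpol_ring V) ?p s = ?Q"
      by (simp add: ideal_power_mspan[OF upset_meets] epow_meets[OF P'])
    have "upset V {t \<in> expo V. s \<le> pdeg P t}" by (auto simp: upset_def pdeg_add)
    note idQ = ideal_mspan[OF this, where 'k = 'k]
    interpret L: cring "loc_prime V ?p" by (rule cring_loc_prime[OF prime])
    have "(1 :: 'k mpol) \<in> carrier (mpol_ring V) - ?p"
      by (simp add: carrier_mpol_ring mspan_def meets_def)
    then have "emb ` ?Q \<subseteq> carrier (loc_prime V ?p)"
      using ideal.Icarr[OF idQ] by (auto simp: loc_prime_def)
    note self = L.genideal_self[OF this]
    show ?thesis
      unfolding Q
    proof
      assume "emb f \<in> Idl\<^bsub>loc_prime V ?p\<^esub> (emb ` ?Q)"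
      then obtain u where u: "u \<in> carrier (mpol_ring V) - ?p" "emb u * emb f \<in> emb ` ?Q"
        using Idl_loc_prime_denominator[OF prime idQ] by blast
      then have "u * f \<in> ?Q" unfolding emb_mult[symmetric] by (auto simp: emb_eq_iff simp del: mult_fract)
      then show "f \<in> ?Q"
        using u(1) f mspan_primary[OF P'(1), of u V f s] by (simp add: carrier_mpol_ring)
    qed (use self in blast)
  qed
  show ?thesis
  proof (rule Set.set_eqI)
    fix f :: "'k mpol"
    have "f \<in> symbolic_power V (mspan E) s \<longleftrightarrow>
      f \<in> mspan (expo V) \<and> (\<forall>P\<in>ass_vars V E. f \<in> mspan {t \<in> expo V. s \<le> pdeg P t})"
      using * by (auto simp: symbolic_power_def assoc_primes_mspan[OF assms] carrier_mpol_ring)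
    then show "f \<in> symbolic_power V (mspan E) s \<longleftrightarrow> f \<in> mspan {t \<in> expo V. \<forall>P\<in>ass_vars V E. s \<le> pdeg P t}"
      by (auto simp: mspan_def subset_iff)
  qed
qed

section \<open>Degree complexes\<close>

text \<open>From here on \<open>emb\<close> is used as a ring homomorphism into a field; unfolding
  fractions would destroy the products of powers of variables.\<close>

declare add_fract [simp del] mult_fract [simp del] minus_fract [simp del] inverse_fract [simp del]

definition expo_of :: "nat set \<Rightarrow> (nat \<Rightarrow> nat) \<Rightarrow> (nat \<Rightarrow>\<^sub>0 nat)" where
  "expo_of V h = (\<Sum>i\<in>V. Poly_Mapping.single i (h i))"

text \<open>Membership of \<open>x\<^sup>\<gamma>\<close> in the localization at the variables in \<open>W\<close>, provided \<open>W\<close> contains all \<open>i\<close> with \<open>\<gamma>\<^sub>i < 0\<close>.\<close>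

definition loc_mem :: "nat set \<Rightarrow> nat set \<Rightarrow> (nat \<Rightarrow> int) \<Rightarrow> (nat \<Rightarrow>\<^sub>0 nat) set \<Rightarrow> bool" where
  "loc_mem V W \<gamma> E \<longleftrightarrow> (\<exists>t\<in>E. \<forall>i\<in>V - W. int (Poly_Mapping.lookup t i) \<le> \<gamma> i)"

lemma lookup_expo_of: "finite V \<Longrightarrow> Poly_Mapping.lookup (expo_of V h) i = (if i \<in> V then h i else 0)"
  by (simp add: expo_of_def lookup_sum lookup_single when_def sum.delta)

lemma expo_of_in_expo: "finite V \<Longrightarrow> expo_of V h \<in> expo V"
  by (auto simp: expo_def in_keys_iff lookup_expo_of split: if_splits)

lemma expo_of_lookup: "finite V \<Longrightarrow> t \<in> expo V \<Longrightarrow> expo_of V (Poly_Mapping.lookup t) = t"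
  by (rule poly_mapping_eqI) (auto simp: lookup_expo_of expo_def in_keys_iff subset_iff)

lemma indet_power: "(indet i :: 'k::field mpol) ^ n = monomial (Poly_Mapping.single i n)"
proof (induction n)
  case (Suc n)
  then show ?case by (simp add: indet_def mult_single single_add[symmetric])
qed simp

lemma emb_power: "emb (f ^ n) = emb f ^ n"
  by (induction n) (simp_all add: emb_1 emb_mult)

lemma emb_indet_nonzero: "emb (indet i :: 'k::field mpol) \<noteq> 0"
proof -
  have "(indet i :: 'k mpol) \<noteq> 0" unfolding indet_def by (metis monomial_in_mspan keys_single keys_zero insert_not_empty zero_neq_one)
  then show ?thesis by (simp add: emb_0[symmetric] emb_eq_iff)
qed

lemma emb_monomial_expo_of:
  "finite V \<Longrightarrow> emb (monomial (expo_of V h) :: 'k::field mpol) = (\<Prod>i\<in>V. emb (indet i) ^ h i)"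
proof (induction V rule: finite_induct)
  case (insert i V)
  have "emb (monomial (expo_of (insert i V) h) :: 'k mpol) = emb (indet i ^ h i * monomial (expo_of V h))"
    using insert(1,2) by (simp add: expo_of_def indet_power mult_single)
  then show ?case by (simp only: emb_mult emb_power prod.insert[OF insert(1,2)] insert(3))
qed (simp add: expo_of_def emb_1)

lemma cring_loc_vars: "cring (loc_vars V W :: 'k::field mpol fract ring)"
  unfolding loc_vars_def
proof (rule cring_class_subring)
  let ?C = "generate_ring cring_class_ops (emb ` carrier (mpol_ring V) \<union> {inverse (emb (indet i)) |i. i \<in> W}) :: 'k mpol fract set"
  show "1 \<in> ?C" using generate_ring.one[of cring_class_ops] unfolding one_class .
  fix f g assume f: "f \<in> ?C"
  show "- f \<in> ?C" using generate_ring.a_inv[OF f] unfolding uminus_class .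
  assume g: "g \<in> ?C"
  show "f + g \<in> ?C" using generate_ring.eng_add[OF f g] unfolding plus_class .
  show "f * g \<in> ?C" using generate_ring.eng_mult[OF f g] unfolding times_class .
qed

text \<open>Induction over the generated ring shows that monomials in W suffice as denominators for
  all elements; the general lemma transfers this to the ideal.\<close>

lemma Idl_loc_vars_denominator:
  fixes Q :: "'k::field mpol set"
  assumes "W \<subseteq> V" and Q: "ideal Q (mpol_ring V)" and z: "z \<in> Idl\<^bsub>loc_vars V W\<^esub> (emb ` Q)"
  shows "\<exists>w\<in>expo W. emb (monomial w) * z \<in> emb ` Q"
proof -
  let ?R = "carrier (mpol_ring V) :: 'k mpol set"
  let ?U = "monomial ` expo W :: 'k mpol set"
  interpret R: cring "mpol_ring V :: 'k mpol ring" by (rule cring_mpol_ring)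
  have U: "?U \<subseteq> ?R" using expo_mono[OF assms(1)] by (auto simp: carrier_mpol_ring)
  have one_U: "1 \<in> ?U" by (rule image_eqI[of _ _ 0]) simp_all
  have mult: "u * v \<in> ?U" if "u \<in> ?U" "v \<in> ?U" for u v
    using that by (force simp: mult_single)
  have mR: "f * g \<in> ?R" and aR: "f + g \<in> ?R" if "f \<in> ?R" "g \<in> ?R" for f g
    using R.m_closed[OF that] R.a_closed[OF that] by simp_all
  have "\<exists>u\<in>?U. emb u * z \<in> emb ` ?R"
    if "z \<in> generate_ring cring_class_ops (emb ` ?R \<union> {inverse (emb (indet i)) |i. i \<in> W})" for z
    using that
  proof (induction rule: generate_ring.induct)
    case one
    have "emb (1 :: 'k mpol) * 1 = emb 1" "(1 :: 'k mpol) \<in> ?R" using R.one_closed by simp_all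
    then show ?case unfolding one_class using one_U by blast
  next
    case (incl h)
    then consider f where "f \<in> ?R" "h = emb f" | i where "i \<in> W" "h = inverse (emb (indet i))" by blast
    then show ?case
    proof cases
      case 1
      then have "emb 1 * h = emb f" by (simp add: emb_1)
      then show ?thesis using one_U 1 by blast
    next
      case 2
      then have "emb (indet i) * h = emb 1" using emb_indet_nonzero[of i, where 'k = 'k] by (simp add: emb_1)
      moreover have "indet i \<in> ?U" using 2 by (auto simp: indet_def expo_def)
      moreover have "(1 :: 'k mpol) \<in> ?R" using R.one_closed by simp
      ultimately show ?thesis by blast
    qed
  next
    case (a_inv h)
    then obtain u f where *: "u \<in> ?U" "emb u * h = emb f" "f \<in> ?R" by blast
    then have "emb u * (- h) = emb (- f)" by (simp only: emb_uminus mult_minus_right)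
    moreover have "- f \<in> ?R" using * mspan_uminus by (simp add: carrier_mpol_ring)
    ultimately show ?case unfolding uminus_class using *(1) by blast
  next
    case (eng_add h1 h2)
    then obtain u f v g where *: "u \<in> ?U" "emb u * h1 = emb f" "f \<in> ?R" "v \<in> ?U" "emb v * h2 = emb g" "g \<in> ?R" by blast
    have "emb (u * v) * (h1 + h2) = emb v * (emb u * h1) + emb u * (emb v * h2)"
      unfolding emb_mult by (simp only: algebra_simps)
    also have "\<dots> = emb (v * f + u * g)" by (simp only: * emb_mult emb_add)
    finally have "emb (u * v) * (h1 + h2) = emb (v * f + u * g)" .
    moreover have "v * f + u * g \<in> ?R" by (intro aR mR subsetD[OF U] *)
    ultimately have "emb (u * v) * (h1 + h2) \<in> emb ` ?R" by (rule image_eqI)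
    then show ?case using mult[OF *(1,4)] unfolding plus_class by blast
  next
    case (eng_mult h1 h2)
    then obtain u f v g where *: "u \<in> ?U" "emb u * h1 = emb f" "f \<in> ?R" "v \<in> ?U" "emb v * h2 = emb g" "g \<in> ?R" by blast
    have "emb (u * v) * (h1 * h2) = (emb u * h1) * (emb v * h2)"
      unfolding emb_mult by (simp only: ac_simps)
    also have "\<dots> = emb (f * g)" by (simp only: * emb_mult)
    finally have "emb (u * v) * (h1 * h2) = emb (f * g)" .
    then have "emb (u * v) * (h1 * h2) \<in> emb ` ?R" using mR[OF *(3,6)] by (rule image_eqI)
    then show ?case using mult[OF *(1,4)] unfolding times_class by blast
  qed
  note denom = this
  have "\<exists>u\<in>?U. emb u * z \<in> emb ` Q"
    by (rule Idl_localization_denominator[OF cring_loc_vars[unfolded loc_vars_def] _ U one_U mult denom Q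
        z[unfolded loc_vars_def]]) (blast intro: generate_ring.incl)
  then show ?thesis by blast
qed

text \<open>Clearing denominators leaves an identity between monomials, from which a term t of the
  numerator can be read off. Conversely, x^\<gamma> is x^t times a Laurent monomial whose negative
  exponents occur only in W.\<close>

lemma laurent_monomial_in_Idl_iff:
  assumes V: "finite V" "W \<subseteq> V" and E: "upset V E" and neg: "neg_indices V \<gamma> \<subseteq> W"
  shows "laurent_monomial V \<gamma> \<in> Idl\<^bsub>loc_vars V W\<^esub> (emb ` (mspan E :: 'k::field mpol set)) \<longleftrightarrow>
    loc_mem V W \<gamma> E"
proof
  let ?x = "\<lambda>i. emb (indet i :: 'k mpol)"
  note nz = emb_indet_nonzero[where 'k = 'k]
  note id = ideal_mspan[OF E, where 'k = 'k]
  \<comment> \<open>a and b are the positive and negative parts of \<gamma>, so x^\<gamma> = x^a /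
    x^b with both in the polynomial ring.\<close>
  define a where "a = expo_of V (\<lambda>i. nat (\<gamma> i))"
  define b where "b = expo_of V (\<lambda>i. nat (- \<gamma> i))"
  have ab: "laurent_monomial V \<gamma> * emb (monomial b :: 'k mpol) = emb (monomial a)"
    unfolding a_def b_def laurent_monomial_def emb_monomial_expo_of[OF V(1)] prod.distrib[symmetric]
    by (intro prod.cong refl) (use nz in \<open>simp add: power_int_def power_inverse\<close>)
  assume "laurent_monomial V \<gamma> \<in> Idl\<^bsub>loc_vars V W\<^esub> (emb ` (mspan E :: 'k mpol set))"
  then obtain w and f :: "'k mpol" where w: "w \<in> expo W" "f \<in> mspan E"
      "emb (monomial w) * laurent_monomial V \<gamma> = emb f"
    using Idl_loc_vars_denominator[OF V(2) id] by blast
  have "emb (monomial (a + w) :: 'k mpol) = emb (monomial w) * emb (monomial a)"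
    by (simp add: emb_mult[symmetric] mult_single add.commute)
  also have "\<dots> = emb f * emb (monomial b)" unfolding ab[symmetric] w(3)[symmetric] by (simp only: ac_simps)
  finally have "monomial (a + w) = f * monomial b" unfolding emb_mult[symmetric] emb_eq_iff .
  \<comment> \<open>The product with x^b has a single exponent, so a term of f must be responsible
    for it. Outside W both w and b vanish, which leaves t = a = \<gamma> there.\<close>
  then have "Poly_Mapping.keys (f * monomial b) = {a + w}" by (metis keys_single zero_neq_one)
  then obtain t where t: "t \<in> Poly_Mapping.keys f" "t + b = a + w"
    unfolding keys_mult_monomial by blast
  have "int (Poly_Mapping.lookup t i) \<le> \<gamma> i" if i: "i \<in> V - W" for i
  proof -
    have "\<gamma> i \<ge> 0" using neg i by (auto simp: neg_indices_def not_less)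
    moreover have "Poly_Mapping.lookup w i = 0" using w(1) i by (auto simp: expo_def in_keys_iff)
    moreover have "Poly_Mapping.lookup t i + Poly_Mapping.lookup b i = Poly_Mapping.lookup a i + Poly_Mapping.lookup w i"
      using t(2) by (metis lookup_add)
    ultimately show ?thesis using i by (simp add: a_def b_def lookup_expo_of[OF V(1)])
  qed
  then show "loc_mem V W \<gamma> E" using t(1) w(2) by (auto simp: loc_mem_def mspan_def)
next
  let ?x = "\<lambda>i. emb (indet i :: 'k mpol)"
  note nz = emb_indet_nonzero[where 'k = 'k]
  interpret L: cring "loc_vars V W :: 'k mpol fract ring" by (rule cring_loc_vars)
  let ?C = "carrier (loc_vars V W) :: 'k mpol fract set"
  assume "loc_mem V W \<gamma> E"
  then obtain t where t: "t \<in> E" "\<And>i. i \<in> V - W \<Longrightarrow> int (Poly_Mapping.lookup t i) \<le> \<gamma> i"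
    by (auto simp: loc_mem_def)
  have RC: "emb ` carrier (mpol_ring V) \<subseteq> ?C" by (auto simp: loc_vars_def intro: generate_ring.incl)
  have inv: "inverse (?x i) \<in> ?C" if "i \<in> W" for i
    using that by (auto simp: loc_vars_def intro: generate_ring.incl)
  have one: "1 \<in> ?C" using L.one_closed by (simp add: loc_vars_def cring_class_ops_def)
  have mult: "y * z \<in> ?C" if "y \<in> ?C" "z \<in> ?C" for y z
    using L.m_closed[OF that] by (simp add: loc_vars_def cring_class_ops_def)
  have pow: "y ^ n \<in> ?C" if "y \<in> ?C" for y n
    by (induction n) (simp_all add: one mult that)
  have xC: "?x i \<in> ?C" if "i \<in> V" for i
    using that RC by (auto simp: carrier_mpol_ring indet_def expo_def)
  \<comment> \<open>A negative exponent can occur only for i in W, where the inverse of x_i is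
    available.\<close>
  have "?x i powi (\<gamma> i - int (Poly_Mapping.lookup t i)) \<in> ?C" if i: "i \<in> V" for i
  proof (cases "i \<in> W")
    case True
    then show ?thesis using pow[OF xC[OF i]] pow[OF inv[OF True]] by (simp add: power_int_def)
  next
    case False
    then show ?thesis using pow[OF xC[OF i]] t(2) i by (simp add: power_int_def)
  qed
  then have "(\<Prod>i\<in>T. ?x i powi (\<gamma> i - int (Poly_Mapping.lookup t i))) \<in> ?C" if "T \<subseteq> V" for T
    using that by (induction T rule: infinite_finite_induct) (auto simp: one mult)
  then have C: "(\<Prod>i\<in>V. ?x i powi (\<gamma> i - int (Poly_Mapping.lookup t i))) \<in> ?C" (is "?y \<in> _") by blast
  have sub: "emb ` (mspan E :: 'k mpol set) \<subseteq> ?C"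
    using RC ideal.Icarr[OF ideal_mspan[OF E, where 'k = 'k]] by blast
  have "emb (monomial t :: 'k mpol) \<in> Idl\<^bsub>loc_vars V W\<^esub> (emb ` mspan E)"
    using L.genideal_self[OF sub] t(1) by auto
  from ideal.I_l_closed[OF L.genideal_ideal[OF sub] this C]
  have "?y * emb (monomial t) \<in> Idl\<^bsub>loc_vars V W\<^esub> (emb ` mspan E)"
    by (simp add: loc_vars_def cring_class_ops_def)
  moreover have "?y * emb (monomial t) = laurent_monomial V \<gamma>"
  proof -
    have "t = expo_of V (Poly_Mapping.lookup t)" using expo_of_lookup[OF V(1)] upset_sub[OF E t(1)] by simp
    then have "?y * emb (monomial t) = ?y * (\<Prod>i\<in>V. ?x i ^ Poly_Mapping.lookup t i)"
      using emb_monomial_expo_of[OF V(1), of "Poly_Mapping.lookup t", where 'k = 'k] by (simp only:)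
    also have "\<dots> = laurent_monomial V \<gamma>"
      unfolding laurent_monomial_def prod.distrib[symmetric]
      by (intro prod.cong refl) (use nz in \<open>simp add: power_int_diff\<close>)
    finally show ?thesis .
  qed
  ultimately show "laurent_monomial V \<gamma> \<in> Idl\<^bsub>loc_vars V W\<^esub> (emb ` (mspan E :: 'k mpol set))" by simp
qed

lemma degree_complex_mspan:
  assumes "finite V" "upset V E"
  shows "degree_complex V \<gamma> (mspan E :: 'k::field mpol set) =
    {F. F \<subseteq> V - neg_indices V \<gamma> \<and> \<not> loc_mem V (F \<union> neg_indices V \<gamma>) \<gamma> E}"
proof -
  have "laurent_monomial V \<gamma> \<in> Idl\<^bsub>loc_vars V (F \<union> neg_indices V \<gamma>)\<^esub> (emb ` (mspan E :: 'k mpol set)) \<longleftrightarrow>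
      loc_mem V (F \<union> neg_indices V \<gamma>) \<gamma> E" if "F \<subseteq> V - neg_indices V \<gamma>" for F
    using that by (intro laurent_monomial_in_Idl_iff assms) (auto simp: neg_indices_def)
  then show ?thesis unfolding degree_complex_def by blast
qed

section \<open>Two blocks of variables\<close>

definition rst :: "nat set \<Rightarrow> (nat \<Rightarrow>\<^sub>0 nat) \<Rightarrow> (nat \<Rightarrow>\<^sub>0 nat)" where
  "rst X t = expo_of X (Poly_Mapping.lookup t)"

text \<open>For an up-closed E in the block X this is the exponent set of the extended ideal, by
  \<open>msum_expo\<close>.\<close>

definition cyl :: "nat set \<Rightarrow> nat set \<Rightarrow> (nat \<Rightarrow>\<^sub>0 nat) set \<Rightarrow> (nat \<Rightarrow>\<^sub>0 nat) set" where
  "cyl V X E = {t \<in> expo V. rst X t \<in> E}"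

definition sympow :: "nat set \<Rightarrow> (nat \<Rightarrow>\<^sub>0 nat) set \<Rightarrow> nat \<Rightarrow> (nat \<Rightarrow>\<^sub>0 nat) set" where
  "sympow V E s = {t \<in> expo V. \<forall>P\<in>ass_vars V E. s \<le> pdeg P t}"

text \<open>The outcome of \<open>degree_complex_mspan\<close> under its own name, with no trace of
  the field left.\<close>

definition dcomplex :: "nat set \<Rightarrow> (nat \<Rightarrow> int) \<Rightarrow> (nat \<Rightarrow>\<^sub>0 nat) set \<Rightarrow> nat set set" where
  "dcomplex V \<gamma> E = {F. F \<subseteq> V - neg_indices V \<gamma> \<and> \<not> loc_mem V (F \<union> neg_indices V \<gamma>) \<gamma> E}"

lemma lookup_rst: "finite X \<Longrightarrow> Poly_Mapping.lookup (rst X t) i = (if i \<in> X then Poly_Mapping.lookup t i else 0)"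
  by (simp add: rst_def lookup_expo_of)

lemma rst_expo: "finite X \<Longrightarrow> rst X t \<in> expo X"
  by (simp add: rst_def expo_of_in_expo)

lemma rst_add: "finite X \<Longrightarrow> rst X (t + u) = rst X t + rst X u"
  by (rule poly_mapping_eqI) (simp add: lookup_rst lookup_add)

lemma rst_id: "finite X \<Longrightarrow> t \<in> expo X \<Longrightarrow> rst X t = t"
  by (simp add: rst_def expo_of_lookup)

lemma rst_other: "finite X \<Longrightarrow> t \<in> expo Y \<Longrightarrow> X \<inter> Y = {} \<Longrightarrow> rst X t = 0"
  by (rule poly_mapping_eqI) (auto simp: lookup_rst expo_def in_keys_iff)

lemma rst_eq_0_iff: "finite X \<Longrightarrow> rst X t = 0 \<longleftrightarrow> Poly_Mapping.keys t \<inter> X = {}"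
  by (auto simp: poly_mapping_eq_iff fun_eq_iff lookup_rst in_keys_iff)

lemma keys_rst: "finite X \<Longrightarrow> Poly_Mapping.keys (rst X t) = Poly_Mapping.keys t \<inter> X"
  by (auto simp: in_keys_iff lookup_rst split: if_splits)

lemma upset_sympow: "upset V (sympow V E s)"
  by (auto simp: upset_def sympow_def pdeg_add intro: trans_le_add1)

lemma epow_Suc_subset: "upset V E \<Longrightarrow> epow V E (Suc s) \<subseteq> epow V E s"
  using upsetD[OF upset_epow] upset_sub by (fastforce simp: msum_def)

lemma epow_antimono: "upset V E \<Longrightarrow> i \<le> j \<Longrightarrow> epow V E j \<subseteq> epow V E i"
  by (rule lift_Suc_antimono_le[of "epow V E"]) (auto intro: epow_Suc_subset[THEN subsetD])

lemma epow_add: "upset V E \<Longrightarrow> t \<in> epow V E i \<Longrightarrow> u \<in> epow V E j \<Longrightarrow> t + u \<in> epow V E (i + j)"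
proof (induction j arbitrary: u)
  case 0
  then show ?case using upsetD[OF upset_epow] by simp
next
  case (Suc j)
  then obtain v w where "u = v + w" "v \<in> epow V E j" "w \<in> E" by (auto simp: msum_def)
  with Suc show ?case by (auto simp: msum_def) (metis add.assoc)
qed

lemma loc_mem_mono: "E \<subseteq> F \<Longrightarrow> loc_mem V W \<gamma> E \<Longrightarrow> loc_mem V W \<gamma> F"
  by (auto simp: loc_mem_def)

lemma loc_mem_Un: "loc_mem V W \<gamma> (E \<union> F) \<longleftrightarrow> loc_mem V W \<gamma> E \<or> loc_mem V W \<gamma> F"
  by (auto simp: loc_mem_def)

lemma loc_mem_UN: "loc_mem V W \<gamma> (\<Union>i\<in>A. E i) \<longleftrightarrow> (\<exists>i\<in>A. loc_mem V W \<gamma> (E i))"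
  by (auto simp: loc_mem_def)

lemma loc_mem_expo: "neg_indices V \<gamma> \<subseteq> W \<Longrightarrow> loc_mem V W \<gamma> (expo V)"
  unfolding loc_mem_def by (rule bexI[of _ 0]) (auto simp: neg_indices_def not_less)

text \<open>The conditions for the various P have to be met by one common t. A single choice serves
  them all: t as large as \<gamma> permits outside W, and large enough on W.\<close>

lemma loc_mem_sympow:
  assumes "finite V" "neg_indices V \<gamma> \<subseteq> W"
  shows "loc_mem V W \<gamma> (sympow V E s) \<longleftrightarrow> (\<forall>P\<in>ass_vars V E. P \<inter> W \<noteq> {} \<or> int s \<le> sum \<gamma> P)"
proof
  assume "loc_mem V W \<gamma> (sympow V E s)"
  then obtain t where t: "t \<in> sympow V E s" "\<And>i. i \<in> V - W \<Longrightarrow> int (Poly_Mapping.lookup t i) \<le> \<gamma> i"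
    by (auto simp: loc_mem_def)
  show "\<forall>P\<in>ass_vars V E. P \<inter> W \<noteq> {} \<or> int s \<le> sum \<gamma> P"
  proof (intro ballI, rule disjCI)
    fix P assume P: "P \<in> ass_vars V E" "\<not> int s \<le> sum \<gamma> P"
    show "P \<inter> W \<noteq> {}"
    proof
      assume "P \<inter> W = {}"
      then have "int (pdeg P t) \<le> sum \<gamma> P"
        unfolding pdeg_def of_nat_sum using P(1) by (intro sum_mono t) (auto simp: ass_vars_def)
      moreover have "s \<le> pdeg P t" using t(1) P(1) by (auto simp: sympow_def)
      ultimately show False using P(2) by simp
    qed
  qed
next
  assume *: "\<forall>P\<in>ass_vars V E. P \<inter> W \<noteq> {} \<or> int s \<le> sum \<gamma> P"
  \<comment> \<open>Coordinates in W are unconstrained; the value s at a single one of them already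
    gives degree s to every P that meets W.\<close>
  define t where "t = expo_of V (\<lambda>i. if i \<in> W then s else nat (\<gamma> i))"
  have lt: "Poly_Mapping.lookup t i = (if i \<in> W then s else nat (\<gamma> i))" if "i \<in> V" for i
    using that by (simp add: t_def lookup_expo_of[OF assms(1)])
  have pos: "0 \<le> \<gamma> i" if "i \<in> V - W" for i using assms(2) that by (auto simp: neg_indices_def not_less)
  have "s \<le> pdeg P t" if P: "P \<in> ass_vars V E" for P
  proof (cases "P \<inter> W = {}")
    case True
    have "int (pdeg P t) = sum \<gamma> P"
      unfolding pdeg_def of_nat_sum
    proof (rule sum.cong)
      fix i assume "i \<in> P"
      then have "i \<in> V - W" using P True by (auto simp: ass_vars_def)
      then show "int (Poly_Mapping.lookup t i) = \<gamma> i" using lt[of i] pos[of i] by simp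
    qed simp
    then show ?thesis using * P True by force
  next
    case False
    then obtain i where i: "i \<in> P" "i \<in> W" by blast
    have P': "finite P" "P \<subseteq> V" using P assms(1) by (auto simp: ass_vars_def intro: finite_subset)
    have "Poly_Mapping.lookup t i \<le> pdeg P t"
      unfolding pdeg_def by (rule member_le_sum) (use i P' in auto)
    then show ?thesis using lt[of i] i P' by auto
  qed
  then have "t \<in> sympow V E s" by (simp add: sympow_def t_def expo_of_in_expo[OF assms(1)])
  then show "loc_mem V W \<gamma> (sympow V E s)"
    unfolding loc_mem_def using lt pos by (auto intro!: bexI[of _ t])
qed

text \<open>The best i is the last one before P fails, since a larger i weakens the demand on Q. If
  j is the first failure of P, then i = j - 1 and s - i = s - j + 1.\<close>

lemma ex_split_antimono:
  fixes P Q :: "nat \<Rightarrow> bool"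
  assumes "P 0" "Q 0" and P: "\<And>i j. i \<le> j \<Longrightarrow> P j \<Longrightarrow> P i" and Q: "\<And>i j. i \<le> j \<Longrightarrow> Q j \<Longrightarrow> Q i"
  shows "(\<exists>i\<le>s. P i \<and> Q (s - i)) \<longleftrightarrow> \<not> (\<exists>j\<in>{1..s}. \<not> P j \<and> \<not> Q (s - j + 1))"
proof
  assume "\<exists>i\<le>s. P i \<and> Q (s - i)"
  then obtain i where i: "i \<le> s" "P i" "Q (s - i)" by blast
  have "P j \<or> Q (s - j + 1)" if j: "j \<in> {1..s}" for j
  proof (cases "j \<le> i")
    case False
    then have "s - j + 1 \<le> s - i" using j by auto
    then show ?thesis using Q i by blast
  qed (use P i in blast)
  then show "\<not> (\<exists>j\<in>{1..s}. \<not> P j \<and> \<not> Q (s - j + 1))" by blast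
next
  assume *: "\<not> (\<exists>j\<in>{1..s}. \<not> P j \<and> \<not> Q (s - j + 1))"
  show "\<exists>i\<le>s. P i \<and> Q (s - i)"
  proof (cases "P s")
    case True
    then show ?thesis using assms(2) by (intro exI[of _ s]) simp
  next
    case False
    \<comment> \<open>The first index at which P fails; it is positive because \<open>P 0\<close>
      holds, so it has a predecessor.\<close>
    define j where "j = (LEAST j. \<not> P j)"
    have "\<not> P j" unfolding j_def by (rule LeastI[of "\<lambda>j. \<not> P j", OF False])
    moreover have "j \<le> s" unfolding j_def by (rule Least_le[of "\<lambda>j. \<not> P j", OF False])
    ultimately obtain i where i: "j = Suc i" using assms(1) by (cases j) auto
    have "P i" using not_less_Least[of i "\<lambda>j. \<not> P j"] i unfolding j_def by auto
    moreover have "Q (s - i)" using * \<open>\<not> P j\<close> \<open>j \<le> s\<close> i by (auto simp: Suc_diff_Suc dest!: bspec[of _ _ j])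
    ultimately show ?thesis using \<open>j \<le> s\<close> i by (intro exI[of _ i]) simp
  qed
qed

lemma cjoin_commute: "cjoin A B = cjoin B A"
  unfolding cjoin_def by (metis sup_commute)

lemma dcomplex_Pow: "dcomplex X \<gamma> E \<subseteq> Pow X"
  by (auto simp: dcomplex_def)

section \<open>The variables of A and B as two disjoint blocks\<close>

locale two_blocks =
  fixes X Y V :: "nat set"
  assumes fin: "finite X" "finite Y" and disj: "X \<inter> Y = {}" and V_eq: "V = X \<union> Y"
begin

text \<open>The setting is symmetric, so statements about the block X are reused for Y.\<close>

lemma swap: "two_blocks Y X V"
  using fin disj V_eq by unfold_locales auto

lemma finV: "finite V" using fin V_eq by simp

lemma expoX: "t \<in> expo X \<Longrightarrow> t \<in> expo V" and expoY: "t \<in> expo Y \<Longrightarrow> t \<in> expo V"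
  using expo_mono V_eq by blast+

lemma rst_decomp: "t \<in> expo V \<Longrightarrow> rst X t + rst Y t = t"
  using disj by (intro poly_mapping_eqI) (auto simp: lookup_rst fin lookup_add expo_def V_eq in_keys_iff)

lemma rst_sum: "a \<in> expo X \<Longrightarrow> b \<in> expo Y \<Longrightarrow> rst X (a + b) = a" "a \<in> expo X \<Longrightarrow> b \<in> expo Y \<Longrightarrow> rst Y (a + b) = b"
  using fin disj by (simp_all add: rst_add rst_id rst_other Int_commute)

lemma msum_expo: 
  assumes "upset X E"
  shows "msum E (expo V) = cyl V X E"
proof (intro Set.set_eqI iffI)
  fix t assume "t \<in> msum E (expo V)"
  then obtain a b where "t = a + b" "a \<in> E" "b \<in> expo V" by (auto simp: msum_def)
  then show "t \<in> cyl V X E"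
    using upset_sub[OF assms, of a] upsetD[OF assms] expoX
    by (simp add: cyl_def rst_add rst_id rst_expo fin)
next
  fix t assume "t \<in> cyl V X E"
  then have "t = rst X t + rst Y t" "rst X t \<in> E" "rst Y t \<in> expo V"
    using rst_decomp expoY rst_expo[OF fin(2)] by (auto simp: cyl_def)
  then show "t \<in> msum E (expo V)" unfolding msum_def by blast
qed

lemma upset_cyl:
  assumes "upset X E"
  shows "upset V (cyl V X E)"
  using upset_gen[of E V] msum_expo[OF assms] upset_sub[OF assms] expoX by auto

text \<open>In disjoint variables the product of two ideals is their intersection: t is the sum of
  its two block parts, and each part alone lies in one factor.\<close>

lemma msum_cyl:
  assumes "upset X E" "upset Y F"
  shows "msum (cyl V X E) (cyl V Y F) = cyl V X E \<inter> cyl V Y F"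
proof (intro Set.set_eqI iffI)
  fix t assume "t \<in> msum (cyl V X E) (cyl V Y F)"
  then show "t \<in> cyl V X E \<inter> cyl V Y F"
    using upsetD[OF assms(1)] upsetD'[OF assms(2)] fin
    by (auto simp: msum_def cyl_def rst_add rst_expo)
next
  fix t assume t: "t \<in> cyl V X E \<inter> cyl V Y F"
  then have "t = rst X t + rst Y t" using rst_decomp by (simp add: cyl_def)
  moreover have "rst X t \<in> cyl V X E" "rst Y t \<in> cyl V Y F"
    using t expoX expoY by (auto simp: cyl_def rst_id rst_expo fin)
  ultimately show "t \<in> msum (cyl V X E) (cyl V Y F)" unfolding msum_def by blast
qed

text \<open>The binomial expansion of (I + J)^s, with each product I^i J^(s-i) written as an
  intersection.\<close>

lemma epow_cyl:
  assumes E: "upset X E" and F: "upset Y F"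
  shows "epow V (cyl V X E \<union> cyl V Y F) s = (\<Union>i\<in>{..s}. cyl V X (epow X E i) \<inter> cyl V Y (epow Y F (s - i)))"
proof (induction s)
  case 0
  then show ?case using rst_expo fin by (auto simp: cyl_def)
next
  case (Suc s)
  show ?case
  proof (intro Set.set_eqI iffI)
    fix t assume "t \<in> epow V (cyl V X E \<union> cyl V Y F) (Suc s)"
    then have "t \<in> msum (\<Union>i\<in>{..s}. cyl V X (epow X E i) \<inter> cyl V Y (epow Y F (s - i))) (cyl V X E \<union> cyl V Y F)"
      by (simp only: epow.simps Suc)
    then obtain u v i where uv: "t = u + v" "u \<in> expo V" "v \<in> expo V" "i \<le> s" "rst X u \<in> epow X E i"
      "rst Y u \<in> epow Y F (s - i)" "rst X v \<in> E \<or> rst Y v \<in> F"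
      unfolding msum_def cyl_def by blast
    from uv(7) show "t \<in> (\<Union>i\<in>{..Suc s}. cyl V X (epow X E i) \<inter> cyl V Y (epow Y F (Suc s - i)))"
    proof
      assume "rst X v \<in> E"
      then have "rst X t \<in> epow X E (Suc i)" using uv by (auto simp: msum_def rst_add fin)
      moreover have "rst Y t \<in> epow Y F (Suc s - Suc i)"
        using uv upsetD[OF upset_epow[OF F]] by (simp add: rst_add rst_expo fin)
      ultimately show ?thesis using uv by (intro UN_I[of "Suc i"]) (auto simp: cyl_def)
    next
      assume "rst Y v \<in> F"
      then have "rst Y t \<in> epow Y F (Suc s - i)" using uv by (auto simp: msum_def rst_add fin Suc_diff_le)
      moreover have "rst X t \<in> epow X E i"
        using uv upsetD[OF upset_epow[OF E]] by (simp add: rst_add rst_expo fin)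
      ultimately show ?thesis using uv by (intro UN_I[of i]) (auto simp: cyl_def)
    qed
  next
    fix t assume "t \<in> (\<Union>i\<in>{..Suc s}. cyl V X (epow X E i) \<inter> cyl V Y (epow Y F (Suc s - i)))"
    then obtain i where i: "i \<le> Suc s" "t \<in> expo V" "rst X t \<in> epow X E i" "rst Y t \<in> epow Y F (Suc s - i)"
      by (auto simp: cyl_def)
    note t = rst_decomp[OF i(2)]
    show "t \<in> epow V (cyl V X E \<union> cyl V Y F) (Suc s)"
    \<comment> \<open>One factor has to be peeled off: from J if i = 0, when no factor of I is at
      hand, and otherwise from I, so that the index drops to j.\<close>
    proof (cases i)
      case 0
      then obtain c d where cd: "rst Y t = c + d" "c \<in> epow Y F s" "d \<in> F"
        using i by (auto simp: msum_def)
      have cd': "c \<in> expo Y" "d \<in> expo Y" using cd upset_sub[OF upset_epow[OF F]] upset_sub[OF F] by auto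
      have "rst X t + c \<in> epow V (cyl V X E \<union> cyl V Y F) s"
        unfolding Suc using cd cd' expoX expoY i 0 rst_expo[OF fin(1)]
        by (intro UN_I[of 0]) (auto simp: cyl_def rst_sum)
      moreover have "d \<in> cyl V Y F" using cd cd' expoY by (simp add: cyl_def rst_id fin)
      moreover have "t = (rst X t + c) + d" using t cd by (simp add: add.assoc)
      ultimately show ?thesis unfolding epow.simps msum_def by blast
    next
      case (Suc j)
      then obtain c d where cd: "rst X t = c + d" "c \<in> epow X E j" "d \<in> E"
        using i by (auto simp: msum_def)
      have cd': "c \<in> expo X" "d \<in> expo X" using cd upset_sub[OF upset_epow[OF E]] upset_sub[OF E] by auto
      have "c + rst Y t \<in> epow V (cyl V X E \<union> cyl V Y F) s"
        unfolding Suc.IH using cd cd' expoX expoY i Suc rst_expo[OF fin(2)]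
        by (intro UN_I[of j]) (auto simp: cyl_def rst_sum)
      moreover have "d \<in> cyl V X E" using cd cd' expoX by (simp add: cyl_def rst_id fin)
      moreover have "t = (c + rst Y t) + d" using t cd by (simp add: ac_simps)
      ultimately show ?thesis unfolding epow.simps msum_def by blast
    qed
  qed
qed

lemma loc_mem_cyl_Int:
  assumes "E \<subseteq> expo X" "F \<subseteq> expo Y"
  shows "loc_mem V W \<gamma> (cyl V X E \<inter> cyl V Y F) \<longleftrightarrow> loc_mem X W \<gamma> E \<and> loc_mem Y W \<gamma> F"
proof
  assume "loc_mem V W \<gamma> (cyl V X E \<inter> cyl V Y F)"
  then obtain t where t: "rst X t \<in> E" "rst Y t \<in> F" "\<And>i. i \<in> V - W \<Longrightarrow> int (Poly_Mapping.lookup t i) \<le> \<gamma> i"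
    by (auto simp: loc_mem_def cyl_def)
  show "loc_mem X W \<gamma> E \<and> loc_mem Y W \<gamma> F"
    unfolding loc_mem_def using t V_eq
    by (intro conjI bexI[OF _ t(1)] bexI[OF _ t(2)]) (auto simp: lookup_rst fin)
next
  assume "loc_mem X W \<gamma> E \<and> loc_mem Y W \<gamma> F"
  then obtain a b where ab: "a \<in> E" "b \<in> F" "\<And>i. i \<in> X - W \<Longrightarrow> int (Poly_Mapping.lookup a i) \<le> \<gamma> i"
    "\<And>i. i \<in> Y - W \<Longrightarrow> int (Poly_Mapping.lookup b i) \<le> \<gamma> i"
    by (auto simp: loc_mem_def)
  have ab': "a \<in> expo X" "b \<in> expo Y" using ab assms by auto
  have "a + b \<in> cyl V X E \<inter> cyl V Y F" using ab ab' expoX expoY by (simp add: cyl_def rst_sum)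
  moreover have "int (Poly_Mapping.lookup (a + b) i) \<le> \<gamma> i" if "i \<in> V - W" for i
  proof (cases "i \<in> X")
    case True
    then have "Poly_Mapping.lookup b i = 0" using ab'(2) disj by (auto simp: expo_def in_keys_iff)
    then show ?thesis using ab(3)[of i] True that by (simp add: lookup_add)
  next
    case False
    then have "Poly_Mapping.lookup a i = 0" using ab'(1) by (auto simp: expo_def in_keys_iff)
    then show ?thesis using ab(4)[of i] False that V_eq by (simp add: lookup_add)
  qed
  ultimately show "loc_mem V W \<gamma> (cyl V X E \<inter> cyl V Y F)" unfolding loc_mem_def by blast
qed

lemma neg_V: "neg_indices V \<gamma> = neg_indices X \<gamma> \<union> neg_indices Y \<gamma>"
  by (auto simp: neg_indices_def V_eq)

text \<open>Disjointness of the blocks makes the two parts of a face of the join unique, namely its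
  traces on X and Y.\<close>

lemma cjoin_iff:
  assumes "A \<subseteq> Pow X" "B \<subseteq> Pow Y"
  shows "F \<in> cjoin A B \<longleftrightarrow> F \<subseteq> V \<and> F \<inter> X \<in> A \<and> F \<inter> Y \<in> B"
proof
  assume "F \<in> cjoin A B"
  then obtain a b where ab: "F = a \<union> b" "a \<in> A" "b \<in> B" by (auto simp: cjoin_def)
  moreover have "a \<subseteq> X" "b \<subseteq> Y" using ab assms by auto
  moreover from this have "F \<inter> X = a" "F \<inter> Y = b" using ab(1) disj by auto
  ultimately show "F \<subseteq> V \<and> F \<inter> X \<in> A \<and> F \<inter> Y \<in> B" using V_eq by auto
next
  assume F: "F \<subseteq> V \<and> F \<inter> X \<in> A \<and> F \<inter> Y \<in> B"
  then have "F = (F \<inter> X) \<union> (F \<inter> Y)" using V_eq by auto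
  then show "F \<in> cjoin A B" using F unfolding cjoin_def by blast
qed

text \<open>\<open>loc_mem X\<close> looks only at coordinates in X, so the same localization set,
  formed for V, can be used in both blocks.\<close>

lemma dcomplex_Int_iff:
  assumes "F \<subseteq> V - neg_indices V \<gamma>"
  shows "F \<inter> X \<in> dcomplex X \<gamma> E \<longleftrightarrow> \<not> loc_mem X (F \<union> neg_indices V \<gamma>) \<gamma> E"
proof -
  have "X - (F \<inter> X \<union> neg_indices X \<gamma>) = X - (F \<union> neg_indices V \<gamma>)"
    using V_eq by (auto simp: neg_indices_def)
  then have "loc_mem X (F \<inter> X \<union> neg_indices X \<gamma>) \<gamma> E = loc_mem X (F \<union> neg_indices V \<gamma>) \<gamma> E"
    by (simp add: loc_mem_def)
  then show ?thesis using assms by (auto simp: dcomplex_def neg_indices_def)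
qed

lemma cjoin_dcomplex_iff:
  "F \<in> cjoin (dcomplex X \<gamma> E) (dcomplex Y \<gamma> E') \<longleftrightarrow> F \<subseteq> V - neg_indices V \<gamma> \<and>
     \<not> loc_mem X (F \<union> neg_indices V \<gamma>) \<gamma> E \<and> \<not> loc_mem Y (F \<union> neg_indices V \<gamma>) \<gamma> E'"
proof (cases "F \<subseteq> V - neg_indices V \<gamma>")
  case True
  then show ?thesis
    using cjoin_iff[OF dcomplex_Pow dcomplex_Pow] dcomplex_Int_iff[OF True]
      two_blocks.dcomplex_Int_iff[OF swap True] by auto
next
  case False
  then show ?thesis
    using cjoin_iff[OF dcomplex_Pow dcomplex_Pow]
    by (auto simp: dcomplex_def neg_indices_def V_eq)
qed

text \<open>A full simplex can have faces that meet the negative indices; the assumption on F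
  excludes them and is what \<open>restrict_complex\<close> provides.\<close>

lemma cjoin_dcomplex_Pow_iff:
  assumes "F \<subseteq> V - neg_indices V \<gamma>"
  shows "F \<in> cjoin (dcomplex X \<gamma> E) (Pow Y) \<longleftrightarrow> \<not> loc_mem X (F \<union> neg_indices V \<gamma>) \<gamma> E"
  using cjoin_iff[OF dcomplex_Pow subset_refl] dcomplex_Int_iff[OF assms] assms by auto

lemma cjoin_Pow_dcomplex_iff:
  assumes "F \<subseteq> V - neg_indices V \<gamma>"
  shows "F \<in> cjoin (Pow X) (dcomplex Y \<gamma> E) \<longleftrightarrow> \<not> loc_mem Y (F \<union> neg_indices V \<gamma>) \<gamma> E"
  using two_blocks.cjoin_dcomplex_Pow_iff[OF swap assms] by (simp add: cjoin_commute)

end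

text \<open>The exponents of \<open>I + J + mn\<close>.\<close>

definition fiber :: "nat set \<Rightarrow> nat set \<Rightarrow> nat set \<Rightarrow> (nat \<Rightarrow>\<^sub>0 nat) set \<Rightarrow> (nat \<Rightarrow>\<^sub>0 nat) set \<Rightarrow> (nat \<Rightarrow>\<^sub>0 nat) set" where
  "fiber V X Y E F = cyl V X E \<union> cyl V Y F \<union> (cyl V X (meets X X) \<inter> cyl V Y (meets Y Y))"

lemma fiber_commute: "fiber V X Y E F = fiber V Y X F E"
  by (auto simp: fiber_def)

section \<open>Products and sums of ideals in separate blocks\<close>

context two_blocks
begin

lemma dcomplex_prod:
  assumes "E \<subseteq> expo X" "F \<subseteq> expo Y"
  shows "dcomplex V \<gamma> (cyl V X E \<inter> cyl V Y F) = restrict_complex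
    (cjoin (dcomplex X \<gamma> E) (Pow Y) \<union> cjoin (Pow X) (dcomplex Y \<gamma> F)) (V - neg_indices V \<gamma>)"
  using cjoin_dcomplex_Pow_iff cjoin_Pow_dcomplex_iff
  by (auto simp: dcomplex_def[of V] restrict_complex_def loc_mem_cyl_Int[OF assms])

text \<open>Negating (a1 and b2) or (a2 and b1) gives four conjunctions. As a1 implies a2 and b1
  implies b2, they collapse to: not a2, or not b2, or neither a1 nor b1.\<close>

lemma dcomplex_mixed:
  assumes "E2 \<subseteq> expo X" "F2 \<subseteq> expo Y" "E1 \<subseteq> E2" "F1 \<subseteq> F2"
  shows "dcomplex V \<gamma> (cyl V X E1 \<inter> cyl V Y F2 \<union> cyl V X E2 \<inter> cyl V Y F1) = restrict_complex
    (cjoin (Pow X) (dcomplex Y \<gamma> F2) \<union> cjoin (dcomplex X \<gamma> E1) (dcomplex Y \<gamma> F1) \<union>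
     cjoin (dcomplex X \<gamma> E2) (Pow Y)) (V - neg_indices V \<gamma>)"
proof -
  have "E1 \<subseteq> expo X" "F1 \<subseteq> expo Y" using assms by auto
  note L = loc_mem_cyl_Int[OF this(1) assms(2)] loc_mem_cyl_Int[OF assms(1) this(2)]
  show ?thesis
    using loc_mem_mono[OF assms(3), of X _ \<gamma>] loc_mem_mono[OF assms(4), of Y _ \<gamma>]
      cjoin_dcomplex_Pow_iff cjoin_Pow_dcomplex_iff
    by (auto simp: dcomplex_def[of V] restrict_complex_def loc_mem_Un L cjoin_dcomplex_iff)
qed

lemma dcomplex_sum_power:
  assumes E: "upset X E" and F: "upset Y F"
  shows "dcomplex V \<gamma> (epow V (cyl V X E \<union> cyl V Y F) s) =
    (\<Union>j\<in>{1..s}. cjoin (dcomplex X \<gamma> (epow X E j)) (dcomplex Y \<gamma> (epow Y F (s - j + 1))))"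
proof (rule Set.set_eqI)
  fix f
  let ?W = "f \<union> neg_indices V \<gamma>"
  have sub: "epow X E i \<subseteq> expo X" "epow Y F i \<subseteq> expo Y" for i
    using upset_epow[OF E] upset_epow[OF F] by (auto simp: upset_def)
  have "loc_mem V ?W \<gamma> (epow V (cyl V X E \<union> cyl V Y F) s) \<longleftrightarrow>
    (\<exists>i\<le>s. loc_mem X ?W \<gamma> (epow X E i) \<and> loc_mem Y ?W \<gamma> (epow Y F (s - i)))"
    unfolding epow_cyl[OF assms] loc_mem_UN loc_mem_cyl_Int[OF sub] by auto
  also have "\<dots> \<longleftrightarrow> \<not> (\<exists>j\<in>{1..s}. \<not> loc_mem X ?W \<gamma> (epow X E j) \<and> \<not> loc_mem Y ?W \<gamma> (epow Y F (s - j + 1)))"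
    by (rule ex_split_antimono)
      (auto intro: loc_mem_expo loc_mem_mono epow_antimono[OF E, THEN subsetD] epow_antimono[OF F, THEN subsetD]
        loc_mem_mono[OF epow_antimono[OF E]] loc_mem_mono[OF epow_antimono[OF F]] simp: neg_V)
  finally show "f \<in> dcomplex V \<gamma> (epow V (cyl V X E \<union> cyl V Y F) s) \<longleftrightarrow>
      f \<in> (\<Union>j\<in>{1..s}. cjoin (dcomplex X \<gamma> (epow X E j)) (dcomplex Y \<gamma> (epow Y F (s - j + 1))))"
    by (auto simp: dcomplex_def[of V] cjoin_dcomplex_iff)
qed

text \<open>A colon ideal of I + J at x^(a+b) is the sum of the colon ideals of I at x^a and of J at
  x^b, so witnesses split into, and combine from, the two blocks.\<close>

lemma ass_cyl_Un:
  assumes E: "upset X E" and F: "upset Y F"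
  shows "ass_vars V (cyl V X E \<union> cyl V Y F) = {P \<union> Q | P Q. P \<in> ass_vars X E \<and> Q \<in> ass_vars Y F}"
proof (intro Set.set_eqI iffI)
  fix R assume "R \<in> ass_vars V (cyl V X E \<union> cyl V Y F)"
  then obtain t where R: "R \<subseteq> V" and t: "t \<in> expo V"
    "\<And>u. u \<in> expo V \<Longrightarrow> u + t \<in> cyl V X E \<union> cyl V Y F \<longleftrightarrow> Poly_Mapping.keys u \<inter> R \<noteq> {}"
    by (auto simp: ass_vars_def)
  \<comment> \<open>The case u = 0: t itself is outside the ideal, so multiplying by variables of
    one block cannot bring it in through the other block.\<close>
  have nt: "rst X t \<notin> E" "rst Y t \<notin> F" using t(2)[of 0] t(1) by (auto simp: cyl_def)
  have "u + rst X t \<in> E \<longleftrightarrow> Poly_Mapping.keys u \<inter> (R \<inter> X) \<noteq> {}" if u: "u \<in> expo X" for u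
  proof -
    have "u + t \<in> cyl V X E \<union> cyl V Y F \<longleftrightarrow> u + rst X t \<in> E"
      using u expoX t(1) nt disj by (simp add: cyl_def rst_add fin rst_id rst_other[OF fin(2) u] Int_commute)
    then show ?thesis using t(2)[of u] u expoX by (auto simp: expo_def)
  qed
  then have "R \<inter> X \<in> ass_vars X E" unfolding ass_vars_def using rst_expo[OF fin(1)] by blast
  moreover have "u + rst Y t \<in> F \<longleftrightarrow> Poly_Mapping.keys u \<inter> (R \<inter> Y) \<noteq> {}" if u: "u \<in> expo Y" for u
  proof -
    have "u + t \<in> cyl V X E \<union> cyl V Y F \<longleftrightarrow> u + rst Y t \<in> F"
      using u expoY t(1) nt disj by (simp add: cyl_def rst_add fin rst_id rst_other[OF fin(1) u])
    then show ?thesis using t(2)[of u] u expoY by (auto simp: expo_def)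
  qed
  then have "R \<inter> Y \<in> ass_vars Y F" unfolding ass_vars_def using rst_expo[OF fin(2)] by blast
  moreover have "R = (R \<inter> X) \<union> (R \<inter> Y)" using R V_eq by auto
  ultimately show "R \<in> {P \<union> Q | P Q. P \<in> ass_vars X E \<and> Q \<in> ass_vars Y F}" by blast
next
  fix R assume "R \<in> {P \<union> Q | P Q. P \<in> ass_vars X E \<and> Q \<in> ass_vars Y F}"
  then obtain P Q a b where R: "R = P \<union> Q" "P \<subseteq> X" "Q \<subseteq> Y" and ab: "a \<in> expo X" "b \<in> expo Y"
    "\<And>u. u \<in> expo X \<Longrightarrow> u + a \<in> E \<longleftrightarrow> Poly_Mapping.keys u \<inter> P \<noteq> {}"
    "\<And>u. u \<in> expo Y \<Longrightarrow> u + b \<in> F \<longleftrightarrow> Poly_Mapping.keys u \<inter> Q \<noteq> {}"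
    by (auto simp: ass_vars_def)
  have "u + (a + b) \<in> cyl V X E \<union> cyl V Y F \<longleftrightarrow> Poly_Mapping.keys u \<inter> R \<noteq> {}" if u: "u \<in> expo V" for u
  proof -
    have "u + (a + b) \<in> cyl V X E \<union> cyl V Y F \<longleftrightarrow> rst X u + a \<in> E \<or> rst Y u + b \<in> F"
      using u ab expoX expoY by (simp add: cyl_def rst_add[OF fin(1), of u] rst_add[OF fin(2), of u] rst_sum)
    also have "\<dots> \<longleftrightarrow> Poly_Mapping.keys u \<inter> R \<noteq> {}"
      using R by (auto simp: ab(3)[OF rst_expo[OF fin(1)]] ab(4)[OF rst_expo[OF fin(2)]] keys_rst fin)
    finally show ?thesis .
  qed
  then show "R \<in> ass_vars V (cyl V X E \<union> cyl V Y F)"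
    unfolding ass_vars_def using R V_eq ab expoX expoY by (auto intro!: bexI[of _ "a + b"])
qed

lemma sum_nonneg:
  assumes "neg_indices V \<gamma> \<subseteq> W" "P \<subseteq> V" "P \<inter> W = {}"
  shows "0 \<le> sum \<gamma> P"
  using assms by (intro Groups_Big.sum_nonneg) (auto simp: neg_indices_def not_less subset_iff)

text \<open>For the sums p over P and q over Q of \<gamma>, which are nonnegative away from W, p + q
  < s holds iff some j has p < j and q < s - j + 1.\<close>

lemma dcomplex_sum_sympow:
  assumes E: "upset X E" and F: "upset Y F"
  shows "dcomplex V \<gamma> (sympow V (cyl V X E \<union> cyl V Y F) s) =
    (\<Union>j\<in>{1..s}. cjoin (dcomplex X \<gamma> (sympow X E j)) (dcomplex Y \<gamma> (sympow Y F (s - j + 1))))"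
proof (rule Set.set_eqI)
  fix f
  let ?W = "f \<union> neg_indices V \<gamma>"
  have W: "neg_indices V \<gamma> \<subseteq> ?W" "neg_indices X \<gamma> \<subseteq> ?W" "neg_indices Y \<gamma> \<subseteq> ?W" by (auto simp: neg_V)
  have sum: "sum \<gamma> (P \<union> Q) = sum \<gamma> P + sum \<gamma> Q" if "P \<in> ass_vars X E" "Q \<in> ass_vars Y F" for P Q
    using that disj fin by (intro sum.union_disjoint) (auto simp: ass_vars_def intro: finite_subset)
  have "\<not> loc_mem V ?W \<gamma> (sympow V (cyl V X E \<union> cyl V Y F) s) \<longleftrightarrow>
    (\<exists>P\<in>ass_vars X E. \<exists>Q\<in>ass_vars Y F. (P \<union> Q) \<inter> ?W = {} \<and> \<not> int s \<le> sum \<gamma> (P \<union> Q))"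
    unfolding loc_mem_sympow[OF finV W(1)] ass_cyl_Un[OF assms] by blast
  also have "\<dots> \<longleftrightarrow>
    (\<exists>P\<in>ass_vars X E. \<exists>Q\<in>ass_vars Y F. P \<inter> ?W = {} \<and> Q \<inter> ?W = {} \<and> sum \<gamma> P + sum \<gamma> Q < int s)"
    by (intro bex_cong refl) (simp only: sum Int_Un_distrib2 not_le Un_empty conj_assoc)
  also have "\<dots> \<longleftrightarrow> (\<exists>j\<in>{1..s}. \<not> loc_mem X ?W \<gamma> (sympow X E j) \<and> \<not> loc_mem Y ?W \<gamma> (sympow Y F (s - j + 1)))"
    unfolding loc_mem_sympow[OF fin(1) W(2)] loc_mem_sympow[OF fin(2) W(3)]
  proof
    assume "\<exists>P\<in>ass_vars X E. \<exists>Q\<in>ass_vars Y F. P \<inter> ?W = {} \<and> Q \<inter> ?W = {} \<and> sum \<gamma> P + sum \<gamma> Q < int s"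
    then obtain P Q where PQ: "P \<in> ass_vars X E" "Q \<in> ass_vars Y F" "P \<inter> ?W = {}" "Q \<inter> ?W = {}"
      "sum \<gamma> P + sum \<gamma> Q < int s" by blast
    have "0 \<le> sum \<gamma> P" "0 \<le> sum \<gamma> Q"
      using PQ V_eq by (auto intro!: sum_nonneg[OF W(1)] simp: ass_vars_def)
    \<comment> \<open>The least possible choice is j = p + 1 with p the sum over P; then s - j + 1
      is s - p, which exceeds the sum over Q.\<close>
    then show "\<exists>j\<in>{1..s}. \<not> (\<forall>P\<in>ass_vars X E. P \<inter> ?W \<noteq> {} \<or> int j \<le> sum \<gamma> P) \<and>
        \<not> (\<forall>P\<in>ass_vars Y F. P \<inter> ?W \<noteq> {} \<or> int (s - j + 1) \<le> sum \<gamma> P)"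
      using PQ by (intro bexI[of _ "nat (sum \<gamma> P) + 1"] conjI notI) (fastforce+)
  next
    assume "\<exists>j\<in>{1..s}. \<not> (\<forall>P\<in>ass_vars X E. P \<inter> ?W \<noteq> {} \<or> int j \<le> sum \<gamma> P) \<and>
        \<not> (\<forall>P\<in>ass_vars Y F. P \<inter> ?W \<noteq> {} \<or> int (s - j + 1) \<le> sum \<gamma> P)"
    then obtain j P Q where j: "j \<in> {1..s}" and PQ: "P \<in> ass_vars X E" "Q \<in> ass_vars Y F" "P \<inter> ?W = {}" "Q \<inter> ?W = {}"
      and *: "sum \<gamma> P < int j" "sum \<gamma> Q < int (s - j + 1)" by (auto simp: not_le)
    have "sum \<gamma> P + sum \<gamma> Q < int s" using j * by auto
    then show "\<exists>P\<in>ass_vars X E. \<exists>Q\<in>ass_vars Y F. P \<inter> ?W = {} \<and> Q \<inter> ?W = {} \<and> sum \<gamma> P + sum \<gamma> Q < int s"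
      using PQ by blast
  qed
  finally show "f \<in> dcomplex V \<gamma> (sympow V (cyl V X E \<union> cyl V Y F) s) \<longleftrightarrow>
      f \<in> (\<Union>j\<in>{1..s}. cjoin (dcomplex X \<gamma> (sympow X E j)) (dcomplex Y \<gamma> (sympow Y F (s - j + 1))))"
    by (auto simp: dcomplex_def[of V] cjoin_dcomplex_iff)
qed

section \<open>Powers and symbolic powers of I + J + mn\<close>

lemma upset_fiber:
  assumes "upset X E" "upset Y F"
  shows "upset V (fiber V X Y E F)"
proof -
  have "upset V (cyl V X (meets X X) \<inter> cyl V Y (meets Y Y))"
    using upset_cyl[OF upset_meets] two_blocks.upset_cyl[OF swap upset_meets] by (auto simp: upset_def)
  then show ?thesis unfolding fiber_def
    by (intro upset_Un upset_cyl two_blocks.upset_cyl[OF swap] assms)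
qed

lemma epow_fiber_X:
  assumes E: "upset X E"
  shows "a \<in> epow X E n \<Longrightarrow> a \<in> epow V (fiber V X Y E F) n"
proof (induction n arbitrary: a)
  case (Suc n)
  then obtain c d where cd: "a = c + d" "c \<in> epow X E n" "d \<in> E" by (auto simp: msum_def)
  then have "d \<in> fiber V X Y E F"
    using upset_sub[OF E, of d] expoX by (simp add: fiber_def cyl_def rst_id fin)
  then show ?case using cd Suc.IH by (auto simp: msum_def)
qed (simp add: expoX)

text \<open>Each factor \<open>y\<^sub>k\<close> of \<open>y\<^sup>b\<close> is paired with one factor \<open>x\<^sub>i\<close>; this costs nothing where \<open>x\<^sub>i\<close> is invertible.\<close>

lemma epow_fiber_mixed:
  assumes "i \<in> X"
  shows "b \<in> expo Y \<Longrightarrow> r \<le> pdeg Y b \<Longrightarrow> Poly_Mapping.single i r + b \<in> epow V (fiber V X Y E F) r"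
proof (induction r arbitrary: b)
  case 0
  then show ?case using expoY by simp
next
  case (Suc r)
  obtain u v where uv: "b = u + v" "r \<le> pdeg Y u" "Poly_Mapping.keys v \<inter> Y \<noteq> {}"
    using pdeg_Suc_split[OF fin(2) Suc.prems(2)] by blast
  have uv': "u \<in> expo Y" "v \<in> expo Y" using uv Suc.prems by auto
  have iX: "Poly_Mapping.single i 1 \<in> expo X" using assms by (simp add: expo_def)
  have "Poly_Mapping.single i 1 + v \<in> fiber V X Y E F"
    using iX uv' uv(3) assms expoX expoY by (auto simp: fiber_def cyl_def rst_sum meets_def)
  moreover have "Poly_Mapping.single i (Suc r) + b = (Poly_Mapping.single i r + u) + (Poly_Mapping.single i 1 + v)"
    using single_add[of i r "1::nat"] by (simp add: uv(1) ac_simps)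
  ultimately show ?case using Suc.IH[OF uv'(1) uv(2)] unfolding epow.simps msum_def by blast
qed

text \<open>Each of the s factors either has its x-part in I, and is counted by j, or contributes at
  least one to the y-degree.\<close>

lemma epow_fiber_bound:
  assumes E: "upset X E" and F: "upset Y F" "0 \<notin> F"
  shows "t \<in> epow V (fiber V X Y E F) s \<Longrightarrow> \<exists>j. rst X t \<in> epow X E j \<and> s \<le> j + pdeg Y t"
proof (induction s arbitrary: t)
  case 0
  then show ?case using rst_expo[OF fin(1)] by (intro exI[of _ 0]) simp
next
  case (Suc s)
  then obtain u v where uv: "t = u + v" "u \<in> epow V (fiber V X Y E F) s" "v \<in> fiber V X Y E F"
    by (auto simp: msum_def)
  obtain j where j: "rst X u \<in> epow X E j" "s \<le> j + pdeg Y u" using Suc.IH[OF uv(2)] by blast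
  show ?case
  proof (cases "rst X v \<in> E")
    case True
    then have "rst X t \<in> epow X E (Suc j)" using j uv(1) by (auto simp: msum_def rst_add fin)
    then show ?thesis using j(2) uv(1) by (intro exI[of _ "Suc j"]) (simp add: pdeg_add)
  next
    case False
    \<comment> \<open>The factor now lies in J, which is proper, or in mn; both have positive
      y-degree.\<close>
    then have "rst Y v \<noteq> 0" using uv(3) F(2) by (auto simp: fiber_def cyl_def meets_def)
    then have "pdeg Y v \<noteq> 0" by (simp add: pdeg_eq_0_iff rst_eq_0_iff fin)
    moreover have "rst X t \<in> epow X E j"
      using j(1) uv(1) upsetD[OF upset_epow[OF E]] by (simp add: rst_add rst_expo fin)
    ultimately show ?thesis using j(2) uv(1) by (intro exI[of _ j]) (simp add: pdeg_add)
  qed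
qed

text \<open>Some x_i and some y_k are both inverted, so the element x_i y_k of mn is a unit; its
  s-th power is the witness.\<close>

lemma loc_mem_fiber_power_meets_both:
  assumes "neg_indices V \<gamma> \<subseteq> W" "W \<inter> X \<noteq> {}" "W \<inter> Y \<noteq> {}"
  shows "loc_mem V W \<gamma> (epow V (fiber V X Y E F) s)"
proof -
  obtain i k where ik: "i \<in> W" "i \<in> X" "k \<in> W" "k \<in> Y" using assms by blast
  have "Poly_Mapping.single k s \<in> expo Y" using ik by (simp add: expo_def)
  moreover have "s \<le> pdeg Y (Poly_Mapping.single k s)"
    using ik fin by (simp add: pdeg_def lookup_single when_def)
  ultimately have "Poly_Mapping.single i s + Poly_Mapping.single k s \<in> epow V (fiber V X Y E F) s"
    using epow_fiber_mixed[OF ik(2)] by blast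
  then show ?thesis unfolding loc_mem_def
    using ik assms(1) by (rule_tac bexI) (auto simp: lookup_add lookup_single when_def neg_indices_def not_less)
qed

text \<open>With some x_i inverted and no y_k, the ideal is locally I + n. At most |\<beta>| factors
  can be taken from n, so I has to supply the rest; once |\<beta>| reaches s nothing is left to
  supply.\<close>

lemma loc_mem_fiber_power_X:
  assumes E: "upset X E" and F: "upset Y F" "0 \<notin> F"
    and W: "neg_indices V \<gamma> \<subseteq> W" "W \<inter> X \<noteq> {}" "W \<inter> Y = {}"
  shows "loc_mem V W \<gamma> (epow V (fiber V X Y E F) s) \<longleftrightarrow>
    int s \<le> sum \<gamma> Y \<or> loc_mem X W \<gamma> (epow X E (nat (int s - sum \<gamma> Y)))"
proof
  assume "loc_mem V W \<gamma> (epow V (fiber V X Y E F) s)"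
  then obtain t where t: "t \<in> epow V (fiber V X Y E F) s"
    "\<And>i. i \<in> V - W \<Longrightarrow> int (Poly_Mapping.lookup t i) \<le> \<gamma> i" by (auto simp: loc_mem_def)
  obtain j where j: "rst X t \<in> epow X E j" "s \<le> j + pdeg Y t" using epow_fiber_bound[OF E F t(1)] by blast
  have "int (pdeg Y t) \<le> sum \<gamma> Y"
    unfolding pdeg_def of_nat_sum using W(3) V_eq by (intro sum_mono t) auto
  then have "nat (int s - sum \<gamma> Y) \<le> j" using j(2) by simp
  then have "rst X t \<in> epow X E (nat (int s - sum \<gamma> Y))" using j(1) epow_antimono[OF E] by blast
  then have "loc_mem X W \<gamma> (epow X E (nat (int s - sum \<gamma> Y)))"
    unfolding loc_mem_def using t(2) V_eq by (rule_tac bexI) (auto simp: lookup_rst fin)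
  then show "int s \<le> sum \<gamma> Y \<or> loc_mem X W \<gamma> (epow X E (nat (int s - sum \<gamma> Y)))" ..
next
  assume *: "int s \<le> sum \<gamma> Y \<or> loc_mem X W \<gamma> (epow X E (nat (int s - sum \<gamma> Y)))"
  have nonneg: "0 \<le> \<gamma> k" if "k \<in> V" "k \<notin> W" for k using that W(1) by (auto simp: neg_indices_def not_less)
  have nonnegY: "0 \<le> \<gamma> k" if "k \<in> Y" for k using that W(3) V_eq nonneg by auto
  have sumY: "0 \<le> sum \<gamma> Y" using nonnegY by (intro Groups_Big.sum_nonneg)
  \<comment> \<open>Of the s factors, n are taken from I and r have the form x_i y_k; r is the
    smaller of s and |\<beta>|.\<close>
  obtain n r where nr: "s = n + r" "int r \<le> sum \<gamma> Y" "loc_mem X W \<gamma> (epow X E n)"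
  proof (cases "int s \<le> sum \<gamma> Y")
    case True
    have "loc_mem X W \<gamma> (epow X E 0)" using W(1) neg_V by (auto intro: loc_mem_expo)
    then show ?thesis using that[of 0 s] True by simp
  next
    case False
    then show ?thesis using that[of "nat (int s - sum \<gamma> Y)" "nat (sum \<gamma> Y)"] * sumY by auto
  qed
  obtain i where i: "i \<in> W" "i \<in> X" using W(2) by blast
  obtain a where a: "a \<in> epow X E n" "\<And>i. i \<in> X - W \<Longrightarrow> int (Poly_Mapping.lookup a i) \<le> \<gamma> i"
    using nr(3) by (auto simp: loc_mem_def)
  \<comment> \<open>The full y-part of \<gamma>, which is nonnegative because W contains all
    negative indices and misses Y.\<close>
  define b where "b = expo_of Y (\<lambda>k. nat (\<gamma> k))"
  have b: "b \<in> expo Y" by (simp add: b_def expo_of_in_expo fin)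
  have "int (pdeg Y b) = sum \<gamma> Y"
    unfolding pdeg_def of_nat_sum by (intro sum.cong refl) (simp add: b_def lookup_expo_of fin nonnegY)
  then have "r \<le> pdeg Y b" using nr(2) by simp
  then have "a + (Poly_Mapping.single i r + b) \<in> epow V (fiber V X Y E F) s"
    unfolding nr(1) by (intro epow_add upset_fiber E F epow_fiber_X a epow_fiber_mixed i b)
  moreover have "int (Poly_Mapping.lookup (a + (Poly_Mapping.single i r + b)) k) \<le> \<gamma> k" if k: "k \<in> V - W" for k
  proof -
    have "k \<noteq> i" using k i by blast
    have "a \<in> expo X" using a upset_sub[OF upset_epow[OF E]] by blast
    show ?thesis
    proof (cases "k \<in> X")
      case True
      then have "k \<notin> Y" using disj by blast
      then show ?thesis using True k \<open>k \<noteq> i\<close> a(2)[of k]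
        by (simp add: lookup_add lookup_single b_def lookup_expo_of fin)
    next
      case False
      then have "Poly_Mapping.lookup a k = 0" using \<open>a \<in> expo X\<close> by (auto simp: expo_def in_keys_iff)
      then show ?thesis using False k \<open>k \<noteq> i\<close> V_eq nonnegY[of k]
        by (simp add: lookup_add lookup_single b_def lookup_expo_of fin)
    qed
  qed
  ultimately show "loc_mem V W \<gamma> (epow V (fiber V X Y E F) s)" unfolding loc_mem_def by blast
qed

text \<open>A multiple of t by x-variables has no y-part, so neither J nor mn can contain it, and
  within X only the colon ideal of I is seen.\<close>

lemma ass_fiberD_aux:
  assumes F: "0 \<notin> F" and R: "R \<subseteq> V" and t: "t \<in> expo V" "rst Y t = 0"
    "\<And>u. u \<in> expo V \<Longrightarrow> u + t \<in> fiber V X Y E F \<longleftrightarrow> Poly_Mapping.keys u \<inter> R \<noteq> {}"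
  shows "R \<inter> X \<in> ass_vars X E"
proof -
  have "u + rst X t \<in> E \<longleftrightarrow> Poly_Mapping.keys u \<inter> (R \<inter> X) \<noteq> {}" if u: "u \<in> expo X" for u
  proof -
    have "rst Y (u + t) = 0" using t(2) disj by (simp add: rst_add fin rst_other[OF fin(2) u] Int_commute)
    then have "u + t \<in> fiber V X Y E F \<longleftrightarrow> u + rst X t \<in> E"
      using u expoX t(1) F by (simp add: fiber_def cyl_def rst_add[OF fin(1)] rst_id fin meets_def)
    then show ?thesis using t(3)[of u] u expoX by (auto simp: expo_def)
  qed
  then show ?thesis unfolding ass_vars_def using rst_expo[OF fin(1)] by blast
qed

text \<open>A prime containing mn contains m or n. The witness t is outside mn, so it lives in one
  block, which decides the alternative.\<close>

lemma ass_fiberD: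
  assumes "0 \<notin> E" "0 \<notin> F" "R \<in> ass_vars V (fiber V X Y E F)"
  shows "(Y \<subseteq> R \<and> R \<inter> X \<in> ass_vars X E) \<or> (X \<subseteq> R \<and> R \<inter> Y \<in> ass_vars Y F)"
proof -
  obtain t where R: "R \<subseteq> V" and t: "t \<in> expo V"
    "\<And>u. u \<in> expo V \<Longrightarrow> u + t \<in> fiber V X Y E F \<longleftrightarrow> Poly_Mapping.keys u \<inter> R \<noteq> {}"
    using assms(3) by (auto simp: ass_vars_def)
  have *: "Z \<subseteq> R" if "Z \<subseteq> V" "\<And>i. i \<in> Z \<Longrightarrow> Poly_Mapping.single i 1 + t \<in> fiber V X Y E F" for Z
  proof
    fix i assume "i \<in> Z"
    then show "i \<in> R" using t(2)[of "Poly_Mapping.single i 1"] that by (auto simp: expo_def)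
  qed
  have nt: "t \<notin> fiber V X Y E F" using t(2)[of 0] by simp
  have X_sub: "X \<subseteq> R" if "rst Y t \<noteq> 0"
  proof (rule *)
    fix i assume i: "i \<in> X"
    then show "Poly_Mapping.single i 1 + t \<in> fiber V X Y E F"
      using that t(1) V_eq fin rst_expo[OF fin(1)] rst_expo[OF fin(2)]
      by (auto simp: fiber_def cyl_def meets_def rst_add keys_add_nat keys_rst rst_eq_0_iff expo_def)
  qed (use V_eq in auto)
  have Y_sub: "Y \<subseteq> R" if "rst X t \<noteq> 0"
  proof (rule *)
    fix i assume i: "i \<in> Y"
    then show "Poly_Mapping.single i 1 + t \<in> fiber V X Y E F"
      using that t(1) V_eq fin rst_expo[OF fin(1)] rst_expo[OF fin(2)]
      by (auto simp: fiber_def cyl_def meets_def rst_add keys_add_nat keys_rst rst_eq_0_iff expo_def)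
  qed (use V_eq in auto)
  \<comment> \<open>For t = 0 neither of the two previous facts applies; here x_i y_k in the ideal
    forces i or k into R.\<close>
  have cases: "X \<subseteq> R \<or> Y \<subseteq> R"
  proof (rule ccontr)
    assume "\<not> ?thesis"
    then obtain i k where ik: "i \<in> X" "i \<notin> R" "k \<in> Y" "k \<notin> R" by blast
    define u where "u = Poly_Mapping.single i (1::nat) + Poly_Mapping.single k 1"
    have u: "Poly_Mapping.keys u = {i, k}" by (auto simp: u_def keys_add_nat)
    then have "u \<in> expo V" using ik V_eq by (auto simp: expo_def)
    moreover have "u + t \<in> fiber V X Y E F"
      using ik \<open>u \<in> expo V\<close> t(1) u rst_expo[OF fin(1)] rst_expo[OF fin(2)]
      by (auto simp: fiber_def cyl_def meets_def keys_rst fin keys_add_nat)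
    ultimately show False using t(2)[of u] u ik by simp
  qed
  show ?thesis
  \<comment> \<open>If this fails, then X is contained in R and t has no x-part: either t has a
    y-part and \<open>X_sub\<close> applies, or t has none and Y is not contained in R, so
    \<open>Y_sub\<close> forces t = 0 and \<open>cases\<close> gives the inclusion.\<close>
  proof (cases "rst Y t = 0 \<and> Y \<subseteq> R")
    case True
    then show ?thesis using ass_fiberD_aux[OF assms(2) R t(1) _ t(2)] by blast
  next
    case False
    have "\<not> (rst X t \<noteq> 0 \<and> rst Y t \<noteq> 0)"
      using nt t(1) rst_expo[OF fin(1)] rst_expo[OF fin(2)]
      by (auto simp: fiber_def cyl_def meets_def keys_rst rst_eq_0_iff fin)
    then have "rst X t = 0" "X \<subseteq> R" using False cases X_sub Y_sub by blast+
    then show ?thesis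
      using two_blocks.ass_fiberD_aux[OF swap assms(1) R t(1) _ t(2)[unfolded fiber_commute[of V X Y]]] by blast
  qed
qed

text \<open>The converse of \<open>ass_fiberD\<close> for P different from X. Localization provides
  the variable outside P: in the application P avoids W while W meets X.\<close>

lemma ass_fiberI:
  assumes F: "0 \<notin> F" "upset Y F" and P: "P \<in> ass_vars X E" and i: "i \<in> X" "i \<notin> P"
  shows "P \<union> Y \<in> ass_vars V (fiber V X Y E F)"
proof -
  obtain a where PX: "P \<subseteq> X" and a: "a \<in> expo X"
    "\<And>u. u \<in> expo X \<Longrightarrow> u + a \<in> E \<longleftrightarrow> Poly_Mapping.keys u \<inter> P \<noteq> {}"
    using P by (auto simp: ass_vars_def)
  \<comment> \<open>The factor \<open>x\<^sub>i\<close> keeps the colon ideal in \<open>A\<close>, as \<open>i \<notin> P\<close>, and makes it contain all of \<open>Y\<close>.\<close>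
  define t where "t = Poly_Mapping.single i 1 + a"
  have iX: "Poly_Mapping.single i 1 \<in> expo X" using i by (simp add: expo_def)
  have tX: "t \<in> expo X" using iX a by (simp add: t_def)
  have "u + t \<in> fiber V X Y E F \<longleftrightarrow> Poly_Mapping.keys u \<inter> (P \<union> Y) \<noteq> {}" if u: "u \<in> expo V" for u
  proof -
    have rX: "rst X (u + t) = (rst X u + Poly_Mapping.single i 1) + a"
      using rst_id[OF fin(1) tX] by (simp add: rst_add[OF fin(1), of u] t_def add.assoc)
    have "rst X (u + t) \<in> E \<longleftrightarrow> Poly_Mapping.keys u \<inter> P \<noteq> {}"
      unfolding rX using a(2)[of "rst X u + Poly_Mapping.single i 1"] iX rst_expo[OF fin(1)] i PX
      by (auto simp: keys_add_nat keys_rst fin)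
    moreover have rY: "rst Y (u + t) = rst Y u"
      using rst_other[OF fin(2) tX] disj by (simp add: rst_add fin Int_commute)
    moreover have "rst X (u + t) \<in> meets X X"
      using rst_expo[OF fin(1), of "u + t"] i by (auto simp: meets_def keys_rst fin keys_add_nat t_def)
    moreover have "rst Y u \<in> F \<Longrightarrow> rst Y u \<in> meets Y Y"
      using F rst_expo[OF fin(2), of u] rst_eq_0_iff[OF fin(2), of u]
      by (auto simp: meets_def keys_rst fin)
    moreover have "rst Y u \<in> meets Y Y \<longleftrightarrow> Poly_Mapping.keys u \<inter> Y \<noteq> {}"
      using rst_expo[OF fin(2), of u] by (auto simp: meets_def keys_rst fin)
    ultimately show ?thesis using u tX expoX unfolding fiber_def cyl_def by auto
  qed
  then show ?thesis unfolding ass_vars_def using PX V_eq expoX[OF tX] by blast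
qed

text \<open>Every associated prime contains all variables of one block, hence an inverted variable,
  and disappears in the localization.\<close>

lemma loc_mem_fiber_sympow_meets_both:
  assumes EF: "0 \<notin> E" "0 \<notin> F"
    and W: "neg_indices V \<gamma> \<subseteq> W" "W \<inter> X \<noteq> {}" "W \<inter> Y \<noteq> {}"
  shows "loc_mem V W \<gamma> (sympow V (fiber V X Y E F) s)"
  unfolding loc_mem_sympow[OF finV W(1)] using ass_fiberD[OF EF] W(2,3) by blast

text \<open>Associated primes containing all of X disappear, since W meets X. What survives has
  variables P together with Y, and the y-part of \<gamma> contributes exactly |\<beta>| to its
  degree.\<close>

lemma loc_mem_fiber_sympow_X:
  assumes EF: "0 \<notin> E" "upset Y F" "0 \<notin> F"
    and W: "neg_indices V \<gamma> \<subseteq> W" "W \<inter> X \<noteq> {}" "W \<inter> Y = {}"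
  shows "loc_mem V W \<gamma> (sympow V (fiber V X Y E F) s) \<longleftrightarrow>
    int s \<le> sum \<gamma> Y \<or> loc_mem X W \<gamma> (sympow X E (nat (int s - sum \<gamma> Y)))"
proof -
  have WX: "neg_indices X \<gamma> \<subseteq> W" using W(1) neg_V by auto
  have sumY: "0 \<le> sum \<gamma> Y" using sum_nonneg[OF W(1), of Y] W(3) V_eq by auto
  have sum: "sum \<gamma> (P \<union> Y) = sum \<gamma> P + sum \<gamma> Y" if "P \<subseteq> X" for P
    using that disj fin by (intro sum.union_disjoint) (auto intro: finite_subset)
  have nonneg: "0 \<le> sum \<gamma> P" if "P \<subseteq> X" "P \<inter> W = {}" for P
    using sum_nonneg[OF W(1)] that V_eq by blast
  have "(\<forall>R\<in>ass_vars V (fiber V X Y E F). R \<inter> W \<noteq> {} \<or> int s \<le> sum \<gamma> R) \<longleftrightarrow>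
    (\<forall>P\<in>ass_vars X E. P \<inter> W \<noteq> {} \<or> int s \<le> sum \<gamma> P + sum \<gamma> Y)"
  proof (intro iffI ballI)
    fix P assume *: "\<forall>R\<in>ass_vars V (fiber V X Y E F). R \<inter> W \<noteq> {} \<or> int s \<le> sum \<gamma> R" and P: "P \<in> ass_vars X E"
    have PX: "P \<subseteq> X" using P by (auto simp: ass_vars_def)
    show "P \<inter> W \<noteq> {} \<or> int s \<le> sum \<gamma> P + sum \<gamma> Y"
    proof (cases "P \<inter> W = {}")
      case True
      then obtain i where "i \<in> X" "i \<notin> P" using W(2) by blast
      from ass_fiberI[OF EF(3,2) P this] * show ?thesis
        using W(3) sum[OF PX] True by (auto simp: Int_Un_distrib2 Int_commute)
    qed simp
  next
    fix R assume *: "\<forall>P\<in>ass_vars X E. P \<inter> W \<noteq> {} \<or> int s \<le> sum \<gamma> P + sum \<gamma> Y" and R: "R \<in> ass_vars V (fiber V X Y E F)"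
    show "R \<inter> W \<noteq> {} \<or> int s \<le> sum \<gamma> R"
    proof (cases "X \<subseteq> R")
      case False
      then have "Y \<subseteq> R" "R \<inter> X \<in> ass_vars X E" using ass_fiberD[OF EF(1,3) R] by auto
      moreover have "R = (R \<inter> X) \<union> Y" using \<open>Y \<subseteq> R\<close> R V_eq by (auto simp: ass_vars_def)
      then have "sum \<gamma> R = sum \<gamma> (R \<inter> X) + sum \<gamma> Y" using sum[of "R \<inter> X"] by simp
      ultimately show ?thesis using * by fastforce
    qed (use W(2) in blast)
  qed
  \<comment> \<open>If |\<beta>| is at least s, nonnegativity of the sums over P avoiding W makes
    the right side true; otherwise |\<beta>| is moved across the inequality.\<close>
  moreover have "(int s \<le> sum \<gamma> Y \<or> (\<forall>P\<in>ass_vars X E. P \<inter> W \<noteq> {} \<or> int (nat (int s - sum \<gamma> Y)) \<le> sum \<gamma> P)) \<longleftrightarrow>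
    (\<forall>P\<in>ass_vars X E. P \<inter> W \<noteq> {} \<or> int s \<le> sum \<gamma> P + sum \<gamma> Y)"
  proof (cases "int s \<le> sum \<gamma> Y")
    case True
    have "P \<inter> W \<noteq> {} \<or> int s \<le> sum \<gamma> P + sum \<gamma> Y" if "P \<in> ass_vars X E" for P
      using nonneg[of P] that True by (auto simp: ass_vars_def)
    then show ?thesis using True by blast
  next
    case False
    then show ?thesis by (simp add: le_diff_eq diff_le_eq)
  qed
  ultimately show ?thesis unfolding loc_mem_sympow[OF finV W(1)] loc_mem_sympow[OF fin(1) WX] by blast
qed

text \<open>Powers and symbolic powers enter only through the three local statements, so the case
  analysis on faces is shared.\<close>

lemma nonempty_faces_dcomplex:
  assumes both: "\<And>W. neg_indices V \<gamma> \<subseteq> W \<Longrightarrow> W \<inter> X \<noteq> {} \<Longrightarrow> W \<inter> Y \<noteq> {} \<Longrightarrow> loc_mem V W \<gamma> K"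
    and onX: "\<And>W. neg_indices V \<gamma> \<subseteq> W \<Longrightarrow> W \<inter> X \<noteq> {} \<Longrightarrow> W \<inter> Y = {} \<Longrightarrow>
      loc_mem V W \<gamma> K \<longleftrightarrow> int s \<le> sum \<gamma> Y \<or> loc_mem X W \<gamma> K1"
    and onY: "\<And>W. neg_indices V \<gamma> \<subseteq> W \<Longrightarrow> W \<inter> Y \<noteq> {} \<Longrightarrow> W \<inter> X = {} \<Longrightarrow>
      loc_mem V W \<gamma> K \<longleftrightarrow> int s \<le> sum \<gamma> X \<or> loc_mem Y W \<gamma> K2"
  shows "nonempty_faces (dcomplex V \<gamma> K) =
    (if neg_indices Y \<gamma> = {} \<and> sum \<gamma> Y < int s then nonempty_faces (dcomplex X \<gamma> K1) else {}) \<union>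
    (if neg_indices X \<gamma> = {} \<and> sum \<gamma> X < int s then nonempty_faces (dcomplex Y \<gamma> K2) else {})"
    (is "_ = ?A \<union> ?B")
proof (rule Set.set_eqI)
  fix f
  let ?W = "f \<union> neg_indices V \<gamma>"
  have G: "neg_indices V \<gamma> = neg_indices X \<gamma> \<union> neg_indices Y \<gamma>" "neg_indices X \<gamma> \<subseteq> X" "neg_indices Y \<gamma> \<subseteq> Y"
    by (simp_all add: neg_V) (auto simp: neg_indices_def)
  \<comment> \<open>\<open>?W \<inter> Y = {}\<close> expresses at once that f lies in X and that no
    entry of \<gamma> on Y is negative.\<close>
  have A: "f \<in> ?A \<longleftrightarrow> f \<noteq> {} \<and> f \<subseteq> V - neg_indices V \<gamma> \<and> ?W \<inter> Y = {} \<and> sum \<gamma> Y < int s \<and> \<not> loc_mem X ?W \<gamma> K1"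
    using G disj V_eq by (auto simp: nonempty_faces_def dcomplex_def)
  have B: "f \<in> ?B \<longleftrightarrow> f \<noteq> {} \<and> f \<subseteq> V - neg_indices V \<gamma> \<and> ?W \<inter> X = {} \<and> sum \<gamma> X < int s \<and> \<not> loc_mem Y ?W \<gamma> K2"
    using G disj V_eq by (auto simp: nonempty_faces_def dcomplex_def)
  have D: "f \<in> nonempty_faces (dcomplex V \<gamma> K) \<longleftrightarrow> f \<noteq> {} \<and> f \<subseteq> V - neg_indices V \<gamma> \<and> \<not> loc_mem V ?W \<gamma> K"
    by (auto simp: nonempty_faces_def dcomplex_def)
  show "f \<in> nonempty_faces (dcomplex V \<gamma> K) \<longleftrightarrow> f \<in> ?A \<union> ?B"
  proof (cases "f \<noteq> {} \<and> f \<subseteq> V - neg_indices V \<gamma>")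
    case True
    \<comment> \<open>Here nonemptiness of f matters: at least one variable is inverted.\<close>
    then have ne: "?W \<inter> X \<noteq> {} \<or> ?W \<inter> Y \<noteq> {}" using V_eq by blast
    have sub: "neg_indices V \<gamma> \<subseteq> ?W" by simp
    from ne consider "?W \<inter> X \<noteq> {}" "?W \<inter> Y \<noteq> {}" | "?W \<inter> X \<noteq> {}" "?W \<inter> Y = {}"
      | "?W \<inter> Y \<noteq> {}" "?W \<inter> X = {}" by blast
    then show ?thesis
    proof cases
      case 1
      then show ?thesis unfolding Un_iff A B D using True both[OF sub 1] by (simp only: simp_thms)
    next
      case 2
      then show ?thesis unfolding Un_iff A B D using True onX[OF sub 2] by (simp only: simp_thms not_le de_Morgan_disj)
    next
      case 3
      then show ?thesis unfolding Un_iff A B D using True onY[OF sub 3] by (simp only: simp_thms not_le de_Morgan_disj)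
    qed
  qed (simp only: Un_iff A B D, blast)
qed

lemma nonempty_faces_fiber_power:
  assumes E: "upset X E" "0 \<notin> E" and F: "upset Y F" "0 \<notin> F"
  shows "nonempty_faces (dcomplex V \<gamma> (epow V (fiber V X Y E F) s)) =
    (if neg_indices Y \<gamma> = {} \<and> sum \<gamma> Y < int s
     then nonempty_faces (dcomplex X \<gamma> (epow X E (nat (int s - sum \<gamma> Y)))) else {}) \<union>
    (if neg_indices X \<gamma> = {} \<and> sum \<gamma> X < int s
     then nonempty_faces (dcomplex Y \<gamma> (epow Y F (nat (int s - sum \<gamma> X)))) else {})"
  by (rule nonempty_faces_dcomplex[OF loc_mem_fiber_power_meets_both loc_mem_fiber_power_X[OF E(1) F]
    two_blocks.loc_mem_fiber_power_X[OF swap F(1) E, unfolded fiber_commute[of V Y X]]])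

lemma nonempty_faces_fiber_sympow:
  assumes E: "upset X E" "0 \<notin> E" and F: "upset Y F" "0 \<notin> F"
  shows "nonempty_faces (dcomplex V \<gamma> (sympow V (fiber V X Y E F) s)) =
    (if neg_indices Y \<gamma> = {} \<and> sum \<gamma> Y < int s
     then nonempty_faces (dcomplex X \<gamma> (sympow X E (nat (int s - sum \<gamma> Y)))) else {}) \<union>
    (if neg_indices X \<gamma> = {} \<and> sum \<gamma> X < int s
     then nonempty_faces (dcomplex Y \<gamma> (sympow Y F (nat (int s - sum \<gamma> X)))) else {})"
  by (rule nonempty_faces_dcomplex[OF loc_mem_fiber_sympow_meets_both[OF E(2) F(2)]
    loc_mem_fiber_sympow_X[OF E(2) F]
    two_blocks.loc_mem_fiber_sympow_X[OF swap F(2) E, unfolded fiber_commute[of V Y X]]])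

end

section \<open>Return from exponents to ideals\<close>

lemma (in two_blocks) Idl_extension:
  assumes "upset X E"
  shows "Idl\<^bsub>mpol_ring V\<^esub> (mspan E) = (mspan (cyl V X E) :: 'k::field mpol set)"
  using Idl_mspan[of E V] msum_expo[OF assms] upset_sub[OF assms] expoX by auto

lemma Idl_indets:
  "Idl\<^bsub>mpol_ring X\<^esub> (indet ` X) = (mspan (meets X X) :: 'k::field mpol set)"
proof -
  let ?M = "(\<lambda>i. Poly_Mapping.single i 1) ` X"
  have "msum ?M (expo X) = meets X X"
  proof (intro Set.set_eqI iffI)
    fix t assume "t \<in> msum ?M (expo X)"
    then show "t \<in> meets X X" by (auto simp: msum_def meets_def keys_add_nat expo_def)
  next
    fix t assume t: "t \<in> meets X X"
    then obtain i where i: "i \<in> X" "i \<in> Poly_Mapping.keys t" by (auto simp: meets_def)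
    have eq: "t = Poly_Mapping.single i 1 + (t - Poly_Mapping.single i 1)"
      using i by (intro poly_mapping_eqI) (auto simp: lookup_add lookup_minus lookup_single when_def in_keys_iff)
    then have "t - Poly_Mapping.single i 1 \<in> expo X" using t by (metis (no_types, lifting) expo_add meets_def mem_Collect_eq)
    then show "t \<in> msum ?M (expo X)" using eq i(1) unfolding msum_def by blast
  qed
  moreover have "indet ` X = (monomial ` ?M :: 'k mpol set)" by (auto simp: indet_def image_iff)
  moreover have "?M \<subseteq> expo X" by (auto simp: expo_def)
  ultimately show ?thesis by (simp add: Idl_monomials)
qed

text \<open>Properness is what keeps generators of J at positive y-degree. For J = B the sum I + J +
  mn would be S, with void degree complex, while the set built from I may have faces.\<close>

lemma mspan_proper:
  assumes "upset V E" "(mspan E :: 'k::field mpol set) \<noteq> carrier (mpol_ring V)"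
  shows "0 \<notin> E"
proof
  assume "0 \<in> E"
  then have "E = expo V" using upsetD[OF assms(1), of 0] assms(1) by (auto simp: upset_def)
  then show False using assms(2) by (simp add: carrier_mpol_ring)
qed

theorem theorem1p1:
  fixes m n s :: nat
    and \<gamma> :: "nat \<Rightarrow> int"
    and I J mm nn :: "'k::field_char_0 mpol set"
    and A B S :: "'k mpol ring"
    and VX VY V :: "nat set"
    and ext :: "'k mpol set \<Rightarrow> 'k mpol set"
    and deg\<alpha> deg\<beta> :: int
  defines "VX \<equiv> {1..m}" and "VY \<equiv> {m+1..n}" and "V \<equiv> {1..n}"
  defines "A \<equiv> mpol_ring VX" and "B \<equiv> mpol_ring VY" and "S \<equiv> mpol_ring V"
  defines "mm \<equiv> Idl\<^bsub>A\<^esub> (indet ` VX)" and "nn \<equiv> Idl\<^bsub>B\<^esub> (indet ` VY)"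
  defines "ext \<equiv> (\<lambda>K. Idl\<^bsub>S\<^esub> K)"
  defines "deg\<alpha> \<equiv> (\<Sum>i\<in>VX. \<gamma> i)" and "deg\<beta> \<equiv> (\<Sum>i\<in>VY. \<gamma> i)"
  assumes "m \<le> n" and "s \<ge> 1"
    and "monomial_ideal VX I" and "monomial_ideal VY J"
  shows
    "degree_complex V \<gamma> (ideal_prod S (ext I) (ext J)) =
       restrict_complex
         (cjoin (degree_complex VX \<gamma> I) (Pow VY) \<union> cjoin (Pow VX) (degree_complex VY \<gamma> J))
         (V - neg_indices V \<gamma>)
     \<and>
     degree_complex V \<gamma> (ideal_power S (ext I <+>\<^bsub>S\<^esub> ext J) s) =
       (\<Union>j\<in>{1..s}. cjoin (degree_complex VX \<gamma> (ideal_power A I j))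
                          (degree_complex VY \<gamma> (ideal_power B J (s - j + 1))))
     \<and>
     degree_complex V \<gamma> (symbolic_power V (ext I <+>\<^bsub>S\<^esub> ext J) s) =
       (\<Union>j\<in>{1..s}. cjoin (degree_complex VX \<gamma> (symbolic_power VX I j))
                          (degree_complex VY \<gamma> (symbolic_power VY J (s - j + 1))))
     \<and>
     (squarefree_monomial_ideal VX I \<and> squarefree_monomial_ideal VY J \<and>
      I \<noteq> carrier A \<and> J \<noteq> carrier B \<longrightarrow>
        nonempty_faces (degree_complex V \<gamma>
          (ideal_power S (ext I <+>\<^bsub>S\<^esub> ext J <+>\<^bsub>S\<^esub> ideal_prod S (ext mm) (ext nn)) s)) =
        (if neg_indices VY \<gamma> = {} \<and> deg\<beta> < int s
         then nonempty_faces (degree_complex VX \<gamma> (ideal_power A I (nat (int s - deg\<beta>)))) else {})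
        \<union>
        (if neg_indices VX \<gamma> = {} \<and> deg\<alpha> < int s
         then nonempty_faces (degree_complex VY \<gamma> (ideal_power B J (nat (int s - deg\<alpha>)))) else {}))
     \<and>
     (squarefree_monomial_ideal VX I \<and> squarefree_monomial_ideal VY J \<and>
      I \<noteq> carrier A \<and> J \<noteq> carrier B \<longrightarrow>
        nonempty_faces (degree_complex V \<gamma>
          (symbolic_power V (ext I <+>\<^bsub>S\<^esub> ext J <+>\<^bsub>S\<^esub> ideal_prod S (ext mm) (ext nn)) s)) =
        (if neg_indices VY \<gamma> = {} \<and> deg\<beta> < int s
         then nonempty_faces (degree_complex VX \<gamma> (symbolic_power VX I (nat (int s - deg\<beta>)))) else {})
        \<union>
        (if neg_indices VX \<gamma> = {} \<and> deg\<alpha> < int s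
         then nonempty_faces (degree_complex VY \<gamma> (symbolic_power VY J (nat (int s - deg\<alpha>)))) else {}))
     \<and>
     (\<forall>I1 I2 J1 J2.
        monomial_ideal VX I1 \<and> monomial_ideal VX I2 \<and> I1 \<subseteq> I2 \<and>
        monomial_ideal VY J1 \<and> monomial_ideal VY J2 \<and> J1 \<subseteq> J2 \<longrightarrow>
        degree_complex V \<gamma> (ideal_prod S (ext I1) (ext J2) <+>\<^bsub>S\<^esub> ideal_prod S (ext I2) (ext J1)) =
          restrict_complex
            (cjoin (Pow VX) (degree_complex VY \<gamma> J2) \<union>
             cjoin (degree_complex VX \<gamma> I1) (degree_complex VY \<gamma> J1) \<union>
             cjoin (degree_complex VX \<gamma> I2) (Pow VY))
            (V - neg_indices V \<gamma>))"
proof -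
  interpret two_blocks VX VY V
    unfolding VX_def VY_def V_def using \<open>m \<le> n\<close> by unfold_locales auto
  obtain E where E: "upset VX E" "I = mspan E"
    using monomial_ideal_mspan \<open>monomial_ideal VX I\<close> by blast
  obtain F where F: "upset VY F" "J = mspan F"
    using monomial_ideal_mspan \<open>monomial_ideal VY J\<close> by blast
  note uX = upset_cyl and uY = two_blocks.upset_cyl[OF swap]
  have extX: "ext (mspan E') = mspan (cyl V VX E')" if "upset VX E'" for E'
    unfolding ext_def S_def by (rule Idl_extension[OF that])
  have extY: "ext (mspan F') = mspan (cyl V VY F')" if "upset VY F'" for F'
    unfolding ext_def S_def by (rule two_blocks.Idl_extension[OF swap that])
  have prod: "ideal_prod S (ext (mspan E')) (ext (mspan F')) = mspan (cyl V VX E' \<inter> cyl V VY F')"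
    if "upset VX E'" "upset VY F'" for E' F'
    unfolding extX[OF that(1)] extY[OF that(2)] unfolding S_def
    by (simp add: ideal_prod_mspan[OF uX uY] that msum_cyl)
  have sum: "ext I <+>\<^bsub>S\<^esub> ext J = mspan (cyl V VX E \<union> cyl V VY F)"
    by (simp add: E F extX extY) (simp add: S_def set_add_mspan)
  have u_sum: "upset V (cyl V VX E \<union> cyl V VY F)" by (intro upset_Un uX uY E F)
  have mn: "mm = mspan (meets VX VX)" "nn = mspan (meets VY VY)"
    unfolding mm_def nn_def A_def B_def by (rule Idl_indets)+
  \<comment> \<open>The ideals m and n are themselves spanned by monomials of the two blocks, so mn
    is an instance of \<open>prod\<close>.\<close>
  have fiber: "ext I <+>\<^bsub>S\<^esub> ext J <+>\<^bsub>S\<^esub> ideal_prod S (ext mm) (ext nn) = mspan (fiber V VX VY E F)"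
    unfolding sum mn prod[OF upset_meets upset_meets] fiber_def unfolding S_def by (rule set_add_mspan)
  note u_fiber = upset_fiber[OF E(1) F(1)]
  have dc: "degree_complex V \<gamma> (mspan K :: 'k mpol set) = dcomplex V \<gamma> K" if "upset V K" for K
    unfolding dcomplex_def by (rule degree_complex_mspan[OF finV that])
  have dcX: "degree_complex VX \<gamma> (mspan K :: 'k mpol set) = dcomplex VX \<gamma> K" if "upset VX K" for K
    unfolding dcomplex_def by (rule degree_complex_mspan[OF fin(1) that])
  have dcY: "degree_complex VY \<gamma> (mspan K :: 'k mpol set) = dcomplex VY \<gamma> K" if "upset VY K" for K
    unfolding dcomplex_def by (rule degree_complex_mspan[OF fin(2) that])
  have pow: "degree_complex V \<gamma> (ideal_power S (mspan K) r :: 'k mpol set) = dcomplex V \<gamma> (epow V K r)"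
    if "upset V K" for K r
    unfolding S_def by (simp add: ideal_power_mspan that dc upset_epow)
  have powX: "degree_complex VX \<gamma> (ideal_power A I r) = dcomplex VX \<gamma> (epow VX E r)" for r
    unfolding A_def E(2) by (simp add: ideal_power_mspan E dcX upset_epow)
  have powY: "degree_complex VY \<gamma> (ideal_power B J r) = dcomplex VY \<gamma> (epow VY F r)" for r
    unfolding B_def F(2) by (simp add: ideal_power_mspan F dcY upset_epow)
  have sym: "degree_complex V \<gamma> (symbolic_power V (mspan K) r :: 'k mpol set) = dcomplex V \<gamma> (sympow V K r)"
    if "upset V K" for K r
    unfolding symbolic_power_mspan[OF finV that] sympow_def[symmetric] by (rule dc[OF upset_sympow])
  have symX: "degree_complex VX \<gamma> (symbolic_power VX I r) = dcomplex VX \<gamma> (sympow VX E r)" for r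
    unfolding E(2) symbolic_power_mspan[OF fin(1) E(1)] sympow_def[symmetric] by (rule dcX[OF upset_sympow])
  have symY: "degree_complex VY \<gamma> (symbolic_power VY J r) = dcomplex VY \<gamma> (sympow VY F r)" for r
    unfolding F(2) symbolic_power_mspan[OF fin(2) F(1)] sympow_def[symmetric] by (rule dcY[OF upset_sympow])
  have sub: "E' \<subseteq> expo W" if "upset W E'" for W E' using that by (simp add: upset_def)
  have u_prod: "upset V (cyl V VX E' \<inter> cyl V VY F')" if "upset VX E'" "upset VY F'" for E' F'
    using uX[OF that(1)] uY[OF that(2)] by (auto simp: upset_def)
  have nE: "0 \<notin> E" if "I \<noteq> carrier A" using mspan_proper[OF E(1)] that by (simp add: A_def E(2))
  have nF: "0 \<notin> F" if "J \<noteq> carrier B" using mspan_proper[OF F(1)] that by (simp add: B_def F(2))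
  show ?thesis
  proof (intro conjI impI allI)
    show "degree_complex V \<gamma> (ideal_prod S (ext I) (ext J)) = restrict_complex
         (cjoin (degree_complex VX \<gamma> I) (Pow VY) \<union> cjoin (Pow VX) (degree_complex VY \<gamma> J))
         (V - neg_indices V \<gamma>)"
      unfolding E(2) F(2) prod[OF E(1) F(1)] dc[OF u_prod[OF E(1) F(1)]] dcX[OF E(1)] dcY[OF F(1)]
      by (rule dcomplex_prod[OF sub[OF E(1)] sub[OF F(1)]])
    show "degree_complex V \<gamma> (ideal_power S (ext I <+>\<^bsub>S\<^esub> ext J) s) =
       (\<Union>j\<in>{1..s}. cjoin (degree_complex VX \<gamma> (ideal_power A I j))
                          (degree_complex VY \<gamma> (ideal_power B J (s - j + 1))))"
      unfolding sum pow[OF u_sum] powX powY by (rule dcomplex_sum_power[OF E(1) F(1)])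
    show "degree_complex V \<gamma> (symbolic_power V (ext I <+>\<^bsub>S\<^esub> ext J) s) =
       (\<Union>j\<in>{1..s}. cjoin (degree_complex VX \<gamma> (symbolic_power VX I j))
                          (degree_complex VY \<gamma> (symbolic_power VY J (s - j + 1))))"
      unfolding sum sym[OF u_sum] symX symY by (rule dcomplex_sum_sympow[OF E(1) F(1)])
  next
    assume "squarefree_monomial_ideal VX I \<and> squarefree_monomial_ideal VY J \<and> I \<noteq> carrier A \<and> J \<noteq> carrier B"
    then have "0 \<notin> E" "0 \<notin> F" using nE nF by auto
    note EF = E(1) this(1) F(1) this(2)
    show "nonempty_faces (degree_complex V \<gamma>
          (ideal_power S (ext I <+>\<^bsub>S\<^esub> ext J <+>\<^bsub>S\<^esub> ideal_prod S (ext mm) (ext nn)) s)) =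
        (if neg_indices VY \<gamma> = {} \<and> deg\<beta> < int s
         then nonempty_faces (degree_complex VX \<gamma> (ideal_power A I (nat (int s - deg\<beta>)))) else {})
        \<union>
        (if neg_indices VX \<gamma> = {} \<and> deg\<alpha> < int s
         then nonempty_faces (degree_complex VY \<gamma> (ideal_power B J (nat (int s - deg\<alpha>)))) else {})"
      unfolding fiber pow[OF u_fiber] powX powY deg\<alpha>_def deg\<beta>_def
      by (rule nonempty_faces_fiber_power[OF EF])
    show "nonempty_faces (degree_complex V \<gamma>
          (symbolic_power V (ext I <+>\<^bsub>S\<^esub> ext J <+>\<^bsub>S\<^esub> ideal_prod S (ext mm) (ext nn)) s)) =
        (if neg_indices VY \<gamma> = {} \<and> deg\<beta> < int s
         then nonempty_faces (degree_complex VX \<gamma> (symbolic_power VX I (nat (int s - deg\<beta>)))) else {})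
        \<union>
        (if neg_indices VX \<gamma> = {} \<and> deg\<alpha> < int s
         then nonempty_faces (degree_complex VY \<gamma> (symbolic_power VY J (nat (int s - deg\<alpha>)))) else {})"
      unfolding fiber sym[OF u_fiber] symX symY deg\<alpha>_def deg\<beta>_def
      by (rule nonempty_faces_fiber_sympow[OF EF])
  next
    fix I1 I2 J1 J2 :: "'k mpol set"
    assume *: "monomial_ideal VX I1 \<and> monomial_ideal VX I2 \<and> I1 \<subseteq> I2 \<and>
        monomial_ideal VY J1 \<and> monomial_ideal VY J2 \<and> J1 \<subseteq> J2"
    obtain E1 where E1: "upset VX E1" "I1 = mspan E1" using * monomial_ideal_mspan by blast
    obtain E2 where E2: "upset VX E2" "I2 = mspan E2" using * monomial_ideal_mspan by blast
    obtain F1 where F1: "upset VY F1" "J1 = mspan F1" using * monomial_ideal_mspan by blast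
    obtain F2 where F2: "upset VY F2" "J2 = mspan F2" using * monomial_ideal_mspan by blast
    \<comment> \<open>Inclusion of spans is inclusion of exponent sets; this is the monotonicity
      that \<open>dcomplex_mixed\<close> requires.\<close>
    have le: "E1 \<subseteq> E2" "F1 \<subseteq> F2" using * by (auto simp: E1 E2 F1 F2 mspan_subset_iff)
    have "ideal_prod S (ext I1) (ext J2) <+>\<^bsub>S\<^esub> ideal_prod S (ext I2) (ext J1) =
        mspan (cyl V VX E1 \<inter> cyl V VY F2 \<union> cyl V VX E2 \<inter> cyl V VY F1)"
      unfolding E1(2) E2(2) F1(2) F2(2) prod[OF E1(1) F2(1)] prod[OF E2(1) F1(1)]
      unfolding S_def by (rule set_add_mspan)
    then show "degree_complex V \<gamma> (ideal_prod S (ext I1) (ext J2) <+>\<^bsub>S\<^esub> ideal_prod S (ext I2) (ext J1)) =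
          restrict_complex
            (cjoin (Pow VX) (degree_complex VY \<gamma> J2) \<union>
             cjoin (degree_complex VX \<gamma> I1) (degree_complex VY \<gamma> J1) \<union>
             cjoin (degree_complex VX \<gamma> I2) (Pow VY))
            (V - neg_indices V \<gamma>)"
      using dcomplex_mixed[OF sub[OF E2(1)] sub[OF F2(1)] le, of \<gamma>]
      by (simp add: dc[OF upset_Un[OF u_prod[OF E1(1) F2(1)] u_prod[OF E2(1) F1(1)]]]
          E1(2) E2(2) F1(2) F2(2) dcX[OF E1(1)] dcX[OF E2(1)] dcY[OF F1(1)] dcY[OF F2(1)])
  qed
qed

end
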